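(* Let $f:\mathbb{F}_q^n\times\mathbb{F}_q^n\times\mathbb{F}_q^n\to\mathbb{F}_q$ be a random trilinear form, and let $g:\mathbb{F}_q^n\times\mathbb{F}_q^n\times\mathbb{F}_q^n\to\mathbb{F}_q$ be an arbitrary trilinear form. There exists a deterministic algorithm that decides whether $f$ and $g$ are equivalent in time $q^{O(n)}$, correctly for all but at most a $\frac{1}{q^{\Omega(n)}}$ fraction of $f$.
   Context: A trilinear form $f$ is represented as the 3-way array $(a_{i,j,k})$ with $a_{i,j,k}=f(e_i,e_j,e_k)$, $e_i$ the standard basis vectors; a random trilinear form has all $a_{i,j,k}$ independent and uniform in $\mathbb{F}_q$. $A\in\mathrm{GL}(n,\mathbb{F}_q)$ acts by $(f\circ A)(u,v,w)=f(A^{-1}u,A^{-1}v,A^{-1}w)$, and $f,g$ are equivalent if $f=g\circ A$ for some $A\in\mathrm{GL}(n,\mathbb{F}_q)$. *)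

theory Defs
  imports
    "HOL-Algebra.Ring"
    "HOL-Library.Landau_Symbols"
    "HOL-Probability.Product_PMF"
begin

section \<open>Trilinear forms over a field\<close>

text \<open>
  Since one algorithm has to serve all finite fields and all dimensions, fields are
  records in the sense of HOL-Algebra, and \<open>F\<^sup>n\<close> is the set of extensional functions
  on \<open>{..<n}\<close>. Forms are HOL functions of which only the values on \<open>F\<^sup>n\<close> matter.
\<close>

type_synonym 'a vec = "nat \<Rightarrow> 'a"
type_synonym 'a form = "'a vec \<Rightarrow> 'a vec \<Rightarrow> 'a vec \<Rightarrow> 'a"

definition vecs :: "('a, 'm) ring_scheme \<Rightarrow> nat \<Rightarrow> 'a vec set" where
  "vecs F n = ({..<n} \<rightarrow>\<^sub>E carrier F)"

definition vec_add :: "('a, 'm) ring_scheme \<Rightarrow> nat \<Rightarrow> 'a vec \<Rightarrow> 'a vec \<Rightarrow> 'a vec" where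
  "vec_add F n u v = (\<lambda>i\<in>{..<n}. u i \<oplus>\<^bsub>F\<^esub> v i)"

definition vec_scale :: "('a, 'm) ring_scheme \<Rightarrow> nat \<Rightarrow> 'a \<Rightarrow> 'a vec \<Rightarrow> 'a vec" where
  "vec_scale F n c u = (\<lambda>i\<in>{..<n}. c \<otimes>\<^bsub>F\<^esub> u i)"

definition std_basis :: "('a, 'm) ring_scheme \<Rightarrow> nat \<Rightarrow> nat \<Rightarrow> 'a vec" where
  "std_basis F n i = (\<lambda>j\<in>{..<n}. if j = i then \<one>\<^bsub>F\<^esub> else \<zero>\<^bsub>F\<^esub>)"

definition linear_form :: "('a, 'm) ring_scheme \<Rightarrow> nat \<Rightarrow> ('a vec \<Rightarrow> 'a) \<Rightarrow> bool" where
  "linear_form F n l \<longleftrightarrow>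
     l \<in> vecs F n \<rightarrow> carrier F \<and>
     (\<forall>u\<in>vecs F n. \<forall>v\<in>vecs F n. l (vec_add F n u v) = l u \<oplus>\<^bsub>F\<^esub> l v) \<and>
     (\<forall>c\<in>carrier F. \<forall>u\<in>vecs F n. l (vec_scale F n c u) = c \<otimes>\<^bsub>F\<^esub> l u)"

definition trilinear :: "('a, 'm) ring_scheme \<Rightarrow> nat \<Rightarrow> 'a form \<Rightarrow> bool" where
  "trilinear F n f \<longleftrightarrow>
     (\<forall>u\<in>vecs F n. \<forall>v\<in>vecs F n.
        linear_form F n (\<lambda>x. f x u v) \<and>
        linear_form F n (\<lambda>x. f u x v) \<and>
        linear_form F n (\<lambda>x. f u v x))"

definition array_of_form ::
  "('a, 'm) ring_scheme \<Rightarrow> nat \<Rightarrow> 'a form \<Rightarrow> nat \<times> nat \<times> nat \<Rightarrow> 'a" where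
  "array_of_form F n f = (\<lambda>(i, j, k). f (std_basis F n i) (std_basis F n j) (std_basis F n k))"

definition form_of_array ::
  "('a, 'm) ring_scheme \<Rightarrow> nat \<Rightarrow> (nat \<times> nat \<times> nat \<Rightarrow> 'a) \<Rightarrow> 'a form" where
  "form_of_array F n a = (\<lambda>u v w.
     \<Oplus>\<^bsub>F\<^esub>i\<in>{..<n}. \<Oplus>\<^bsub>F\<^esub>j\<in>{..<n}. \<Oplus>\<^bsub>F\<^esub>k\<in>{..<n}.
       a (i, j, k) \<otimes>\<^bsub>F\<^esub> u i \<otimes>\<^bsub>F\<^esub> v j \<otimes>\<^bsub>F\<^esub> w k)"

text \<open>All \<open>n\<^sup>3\<close> entries are independent and uniform in \<open>F\<close>.\<close>

definition random_trilinear_form :: "('a, 'm) ring_scheme \<Rightarrow> nat \<Rightarrow> 'a form pmf" where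
  "random_trilinear_form F n =
     map_pmf (form_of_array F n)
       (Pi_pmf ({..<n} \<times> {..<n} \<times> {..<n}) \<zero>\<^bsub>F\<^esub> (\<lambda>_. pmf_of_set (carrier F)))"


section \<open>The general linear group and equivalence of forms\<close>

type_synonym 'a sqmat = "nat \<times> nat \<Rightarrow> 'a"

definition mat_monoid :: "('a, 'm) ring_scheme \<Rightarrow> nat \<Rightarrow> 'a sqmat monoid" where
  "mat_monoid F n =
     \<lparr>carrier = ({..<n} \<times> {..<n} \<rightarrow>\<^sub>E carrier F),
      monoid.mult = (\<lambda>A B. \<lambda>(i, k)\<in>{..<n} \<times> {..<n}. \<Oplus>\<^bsub>F\<^esub>j\<in>{..<n}. A (i, j) \<otimes>\<^bsub>F\<^esub> B (j, k)),
      one = (\<lambda>(i, j)\<in>{..<n} \<times> {..<n}. if i = j then \<one>\<^bsub>F\<^esub> else \<zero>\<^bsub>F\<^esub>)\<rparr>"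

definition GL :: "nat \<Rightarrow> ('a, 'm) ring_scheme \<Rightarrow> 'a sqmat monoid" where
  "GL n F = units_of (mat_monoid F n)"

definition mat_vec :: "('a, 'm) ring_scheme \<Rightarrow> nat \<Rightarrow> 'a sqmat \<Rightarrow> 'a vec \<Rightarrow> 'a vec" where
  "mat_vec F n A u = (\<lambda>i\<in>{..<n}. \<Oplus>\<^bsub>F\<^esub>j\<in>{..<n}. A (i, j) \<otimes>\<^bsub>F\<^esub> u j)"

definition form_act :: "('a, 'm) ring_scheme \<Rightarrow> nat \<Rightarrow> 'a form \<Rightarrow> 'a sqmat \<Rightarrow> 'a form" where
  "form_act F n f A = (\<lambda>u v w.
     let B = inv\<^bsub>GL n F\<^esub> A in f (mat_vec F n B u) (mat_vec F n B v) (mat_vec F n B w))"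

definition equivalent_forms :: "('a, 'm) ring_scheme \<Rightarrow> nat \<Rightarrow> 'a form \<Rightarrow> 'a form \<Rightarrow> bool" where
  "equivalent_forms F n f g \<longleftrightarrow>
     (\<exists>A\<in>carrier (GL n F). \<forall>u\<in>vecs F n. \<forall>v\<in>vecs F n. \<forall>w\<in>vecs F n.
        f u v w = form_act F n g A u v w)"


section \<open>Deterministic algorithms\<close>

text \<open>
  Programs are structured programs for a random access machine whose memory consists of
  finitely many named arrays of natural numbers (a scalar variable is cell \<open>0\<close> of its array).
  The only arithmetic is addition and truncated subtraction. Every operation, memory access
  and test costs one time unit. As there is no multiplication, the length of the numbers in
  memory grows by at most a constant per time unit, so that unit cost is polynomially related
  to the running time of a Turing machine.
\<close>

type_synonym vname = string
type_synonym state = "vname \<Rightarrow> nat \<Rightarrow> nat"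

datatype aexp =
    Num nat
  | Cell vname aexp
  | Plus aexp aexp
  | Minus aexp aexp

datatype com =
    Skip
  | Store vname aexp aexp
  | Seq com com
  | If aexp com com
  | While aexp com

fun aval :: "aexp \<Rightarrow> state \<Rightarrow> nat" where
  "aval (Num k) s = k"
| "aval (Cell x a) s = s x (aval a s)"
| "aval (Plus a b) s = aval a s + aval b s"
| "aval (Minus a b) s = aval a s - aval b s"

fun acost :: "aexp \<Rightarrow> nat" where
  "acost (Num k) = 1"
| "acost (Cell x a) = acost a + 1"
| "acost (Plus a b) = acost a + acost b + 1"
| "acost (Minus a b) = acost a + acost b + 1"

text \<open>\<open>exec c s t s'\<close>: started in state \<open>s\<close>, program \<open>c\<close> halts after \<open>t\<close> time units in state \<open>s'\<close>.
  A guard holds iff its value is nonzero.\<close>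

inductive exec :: "com \<Rightarrow> state \<Rightarrow> nat \<Rightarrow> state \<Rightarrow> bool" where
  Skip: "exec Skip s 1 s"
| Store: "exec (Store x a b) s (acost a + acost b + 1) (s(x := (s x)(aval a s := aval b s)))"
| Seq: "exec c s t s' \<Longrightarrow> exec d s' t' s'' \<Longrightarrow> exec (Seq c d) s (t + t') s''"
| IfTrue: "aval b s \<noteq> 0 \<Longrightarrow> exec c s t s' \<Longrightarrow> exec (If b c d) s (acost b + 1 + t) s'"
| IfFalse: "aval b s = 0 \<Longrightarrow> exec d s t s' \<Longrightarrow> exec (If b c d) s (acost b + 1 + t) s'"
| WhileFalse: "aval b s = 0 \<Longrightarrow> exec (While b c) s (acost b + 1) s"
| WhileTrue: "aval b s \<noteq> 0 \<Longrightarrow> exec c s t s' \<Longrightarrow> exec (While b c) s' t' s''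
    \<Longrightarrow> exec (While b c) s (acost b + 1 + t + t') s''"

inductive_cases exec_SkipE: "exec Skip s t s'"
inductive_cases exec_StoreE: "exec (Store x a b) s t s'"
inductive_cases exec_SeqE: "exec (Seq c d) s t s'"
inductive_cases exec_IfE: "exec (If b c d) s t s'"
inductive_cases exec_WhileE: "exec (While b c) s t s'"

lemma exec_deterministic:
  "exec c s t s' \<Longrightarrow> exec c s u r \<Longrightarrow> u = t \<and> r = s'"
proof (induction arbitrary: u r rule: exec.induct)
  case (Skip s)
  from Skip.prems show ?case by (rule exec_SkipE) simp
next
  case (Store x a b s)
  from Store.prems show ?case by (rule exec_StoreE) simp
next
  case (Seq c s t s' d t' s'')
  from Seq.prems show ?case by (rule exec_SeqE) (use Seq.IH in metis)
next
  case (IfTrue b s c t s' d)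
  from IfTrue.prems show ?case
    by (rule exec_IfE) (use IfTrue.hyps in \<open>auto dest: IfTrue.IH\<close>)
next
  case (IfFalse b s d t s' c)
  from IfFalse.prems show ?case
    by (rule exec_IfE) (use IfFalse.hyps in \<open>auto dest: IfFalse.IH\<close>)
next
  case (WhileFalse b s c)
  from WhileFalse.prems show ?case
    by (rule exec_WhileE) (use WhileFalse.hyps in simp_all)
next
  case (WhileTrue b s c t s' t' s'')
  from WhileTrue.prems show ?case
    by (rule exec_WhileE) (use WhileTrue.hyps in \<open>auto dest!: WhileTrue.IH\<close>)
qed

definition halts_within :: "com \<Rightarrow> state \<Rightarrow> real \<Rightarrow> bool" where
  "halts_within c s b \<longleftrightarrow> (\<exists>t s'. exec c s t s' \<and> real t \<le> b)"

definition answers :: "com \<Rightarrow> state \<Rightarrow> bool \<Rightarrow> bool" where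
  "answers c s b \<longleftrightarrow> (\<exists>t s'. exec c s t s' \<and> s' ''out'' 0 = (if b then 1 else 0))"

text \<open>
  The input for a pair of forms over a field with carrier \<open>{..<q}\<close> consists of \<open>q\<close>, \<open>n\<close>, the
  addition and multiplication tables of the field (in row-major order, entry \<open>(x, y)\<close> at
  index \<open>x * q + y\<close>), and the arrays of both forms (entry \<open>(i, j, k)\<close> at index
  \<open>(i * n + j) * n + k\<close>). All other memory cells are \<open>0\<close>.
\<close>

definition table :: "nat \<Rightarrow> (nat \<Rightarrow> nat \<Rightarrow> nat) \<Rightarrow> nat \<Rightarrow> nat" where
  "table q h = (\<lambda>m. if m < q * q then h (m div q) (m mod q) else 0)"

definition flat_array :: "nat \<Rightarrow> (nat \<times> nat \<times> nat \<Rightarrow> nat) \<Rightarrow> nat \<Rightarrow> nat" where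
  "flat_array n a =
     (\<lambda>m. if m < n * n * n then a (m div (n * n), m div n mod n, m mod n) else 0)"

definition input_state :: "nat ring \<Rightarrow> nat \<Rightarrow> nat form \<Rightarrow> nat form \<Rightarrow> state" where
  "input_state F n f g = (\<lambda>_ _. 0)
     (''q'' := (\<lambda>_. 0)(0 := card (carrier F)),
      ''n'' := (\<lambda>_. 0)(0 := n),
      ''add'' := table (card (carrier F)) (add F),
      ''mul'' := table (card (carrier F)) (monoid.mult F),
      ''f'' := flat_array n (array_of_form F n f),
      ''g'' := flat_array n (array_of_form F n g))"

end

theory Submission
  imports Defs
begin

text \<open>
  Fix vectors \<open>a\<close>, \<open>b\<close> such that \<open>f(a, \<cdot>, \<cdot>)\<close> is nondegenerate. Then \<open>f(a, \<cdot>, w) = f(b, \<cdot>, u)\<close> determines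
  \<open>w\<close> from \<open>u\<close>, so a starting vector \<open>u\<^sub>0\<close> determines a chain \<open>u\<^sub>0, u\<^sub>1, \<dots>\<close>, and this construction commutes
  with every equivalence of forms. If the first \<open>n\<close> vectors of the chain form a basis, an
  equivalence from \<open>f\<close> to \<open>g\<close> is therefore determined by the images of \<open>a\<close>, \<open>b\<close> and \<open>u\<^sub>0\<close>. The algorithm
  tries all triples for \<open>f\<close> and all triples for \<open>g\<close>, computes both chains by exhaustive search
  over \<open>F\<^sup>n\<close>, and accepts iff both are bases in which the two forms have the same values.

  It can only err on equivalent forms, and only if no triple yields a basis. For
  \<open>a = e\<^sub>i\<close>, \<open>b = e\<^sub>j\<close>, \<open>u\<^sub>0 = e\<^sub>0\<close> this asks the slice \<open>A\<close> of \<open>f\<close> at \<open>i\<close> to be invertible and \<open>e\<^sub>0\<close> to be a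
  cyclic vector of \<open>A\<^sup>-\<^sup>1B\<close>, where \<open>B\<close> is the slice at \<open>j\<close>. A uniform pair \<open>(A, B)\<close> has this property with
  probability at least \<open>(1 - x - x\<^sup>2)\<^sup>2\<close> for \<open>x = 1/q\<close>, and the \<open>\<lfloor>n/2\<rfloor>\<close> pairs of slices at \<open>2t\<close>, \<open>2t + 1\<close>
  are independent.
\<close>

section \<open>Programs for bounded recursion\<close>

text \<open>Two bases with equal values exhibit an equivalence no matter whether they really are
  chains. Hence a failed search may return any default, degenerate choices need no special
  treatment, and errors are confined to a set of \<open>f\<close> that does not depend on
  \<open>g\<close>, so that one probability bound covers all \<open>g\<close> at once. Enumerating
  the images of a whole basis would cost q^(n^2) choices; a chain reduces this to three vectors on
  each side. All remaining work enumerates a fixed number of further vectors, so the time is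
  polynomial in q^n. The program is not written out: closure properties of functions given by
  bounded loops produce it together with its time bound. The failure bound has to decay in q as well
  as in n. A constant failure rate per pair of slices would only give 2^(-Omega(n)), so each pair
  must fail with probability at most q^(-c) for a fixed c > 0. The exponent c = 1/20 covers both q =
  2, where 1 - x - x^2 is only 1/4, and large q, where the estimated failure rate is about
  2/q.\<close>

definition input_size :: "state \<Rightarrow> nat" where
  "input_size \<sigma> = (\<sigma> ''q'' 0 + 2) ^ (\<sigma> ''n'' 0 + 1)"

text \<open>The summands 2 and 1 in \<open>input_size\<close> guarantee this in every state, even
  when \<open>q\<close> or \<open>n\<close> is 0. A base of at least 2 lets constants and sums be
  absorbed by a larger exponent.\<close>

lemma input_size_ge_2: "2 \<le> input_size \<sigma>"
proof -
  have "2 ^ 1 \<le> (\<sigma> ''q'' 0 + 2) ^ 1" by simp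
  also have "\<dots> \<le> input_size \<sigma>"
    unfolding input_size_def by (rule power_increasing) auto
  finally show ?thesis by simp
qed

text \<open>The exponent is uniform over all states, including those that encode no field or form.
  No invariant on the input has to be carried along, at the price that every loop needs a bound
  valid for arbitrary memory.\<close>

definition poly_time :: "(state \<Rightarrow> nat) \<Rightarrow> bool" where
  "poly_time T \<longleftrightarrow> (\<exists>K. \<forall>\<sigma>. T \<sigma> \<le> input_size \<sigma> ^ K)"

lemma poly_time_mono: "poly_time T \<Longrightarrow> (\<And>\<sigma>. S \<sigma> \<le> T \<sigma>) \<Longrightarrow> poly_time S"
  unfolding poly_time_def by (meson order_trans)

lemma poly_time_const: "poly_time (\<lambda>_. k)"
proof -
  have "k \<le> input_size \<sigma> ^ k" for \<sigma>
  proof -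
    have "k \<le> 2 ^ k" using less_exp[of k] by simp
    also have "\<dots> \<le> input_size \<sigma> ^ k" by (rule power_mono) (auto simp: input_size_ge_2)
    finally show ?thesis .
  qed
  then show ?thesis unfolding poly_time_def by blast
qed

lemma poly_time_mult: "poly_time S \<Longrightarrow> poly_time T \<Longrightarrow> poly_time (\<lambda>\<sigma>. S \<sigma> * T \<sigma>)"
  unfolding poly_time_def by (metis mult_le_mono power_add)

text \<open>Sums reduce to products by \<open>S + T \<le> (S + 1) * (T + 1)\<close>, and a successor
  costs one further factor \<open>input_size\<close>.\<close>

lemma poly_time_add:
  assumes "poly_time S" "poly_time T"
  shows "poly_time (\<lambda>\<sigma>. S \<sigma> + T \<sigma>)"
proof (rule poly_time_mono)
  show "poly_time (\<lambda>\<sigma>. (S \<sigma> + 1) * (T \<sigma> + 1))"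
  proof (rule poly_time_mult)
    have *: "poly_time (\<lambda>\<sigma>. U \<sigma> + 1)" if U: "poly_time U" for U
    proof -
      obtain K where K: "\<And>\<sigma>. U \<sigma> \<le> input_size \<sigma> ^ K" using U by (auto simp: poly_time_def)
      have "U \<sigma> + 1 \<le> input_size \<sigma> ^ Suc K" for \<sigma>
      proof -
        have g: "2 \<le> input_size \<sigma>" by (rule input_size_ge_2)
        have "1 \<le> input_size \<sigma> ^ K" using g by simp
        then have "U \<sigma> + 1 \<le> 2 * input_size \<sigma> ^ K" using K[of \<sigma>] by linarith
        also have "\<dots> \<le> input_size \<sigma> ^ Suc K" using g by simp
        finally show ?thesis .
      qed
      then show ?thesis unfolding poly_time_def by blast
    qed
    show "poly_time (\<lambda>\<sigma>. S \<sigma> + 1)" "poly_time (\<lambda>\<sigma>. T \<sigma> + 1)" using assms by (blast intro: *)+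
  qed
qed (simp add: algebra_simps)

lemmas poly_time_intros = poly_time_const poly_time_add poly_time_mult

lemma poly_time_n: "poly_time (\<lambda>\<sigma>. \<sigma> ''n'' 0)"
proof -
  have "\<sigma> ''n'' 0 \<le> input_size \<sigma> ^ 1" for \<sigma>
  proof -
    have "\<sigma> ''n'' 0 \<le> 2 ^ (\<sigma> ''n'' 0 + 1)"
      by (rule less_imp_le, rule less_le_trans[OF less_exp]) simp
    also have "\<dots> \<le> input_size \<sigma>" unfolding input_size_def by (rule power_mono) auto
    finally show ?thesis by simp
  qed
  then show ?thesis unfolding poly_time_def by blast
qed

lemma poly_time_q: "poly_time (\<lambda>\<sigma>. \<sigma> ''q'' 0)"
proof -
  have "\<sigma> ''q'' 0 \<le> input_size \<sigma> ^ 1" for \<sigma>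
  proof -
    have "\<sigma> ''q'' 0 \<le> (\<sigma> ''q'' 0 + 2) ^ 1" by simp
    also have "\<dots> \<le> input_size \<sigma>" unfolding input_size_def by (rule power_increasing) auto
    finally show ?thesis by simp
  qed
  then show ?thesis unfolding poly_time_def by blast
qed

lemma poly_time_q_power_n: "poly_time (\<lambda>\<sigma>. \<sigma> ''q'' 0 ^ \<sigma> ''n'' 0)"
proof -
  have "\<sigma> ''q'' 0 ^ \<sigma> ''n'' 0 \<le> input_size \<sigma> ^ 1" for \<sigma>
  proof -
    have "\<sigma> ''q'' 0 ^ \<sigma> ''n'' 0 \<le> (\<sigma> ''q'' 0 + 2) ^ \<sigma> ''n'' 0" by (rule power_mono) auto
    also have "\<dots> \<le> input_size \<sigma>" unfolding input_size_def by (rule power_increasing) auto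
    finally show ?thesis by simp
  qed
  then show ?thesis unfolding poly_time_def by blast
qed

text \<open>
  Functions depend on the input \<open>\<sigma>\<close> and on registers \<open>r\<close>, which are kept in the array \<open>m\<close>. Asking
  for a program for every target register \<open>d \<ge> D\<close> makes the notion monotone in \<open>D\<close>, so that an
  argument may be recomputed inside a loop.
\<close>

definition computes ::
  "nat \<Rightarrow> com \<Rightarrow> (state \<Rightarrow> (nat \<Rightarrow> nat) \<Rightarrow> nat) \<Rightarrow> (state \<Rightarrow> nat) \<Rightarrow> bool" where
  "computes d c \<phi> T \<longleftrightarrow> (\<forall>\<sigma> r. \<exists>t r'. exec c (\<sigma>(''m'' := r)) t (\<sigma>(''m'' := r')) \<and>
     t \<le> T \<sigma> \<and> r' d = \<phi> \<sigma> r \<and> (\<forall>i<d. r' i = r i))"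

definition computable :: "nat \<Rightarrow> (state \<Rightarrow> (nat \<Rightarrow> nat) \<Rightarrow> nat) \<Rightarrow> bool" where
  "computable D \<phi> \<longleftrightarrow> (\<forall>\<sigma> r r'. (\<forall>i<D. r i = r' i) \<longrightarrow> \<phi> \<sigma> r = \<phi> \<sigma> r') \<and>
     (\<forall>d\<ge>D. \<exists>c T. poly_time T \<and> computes d c \<phi> T)"

text \<open>Meant for loop counts. A count may depend on registers of surrounding loops, but the
  time bound of a program is a function of the input alone, so the estimate \<open>S\<close> must
  not mention registers.\<close>

definition poly_bounded :: "(state \<Rightarrow> (nat \<Rightarrow> nat) \<Rightarrow> nat) \<Rightarrow> bool" where
  "poly_bounded b \<longleftrightarrow> (\<exists>S. poly_time S \<and> (\<forall>\<sigma> r. b \<sigma> r \<le> S \<sigma>))"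

lemma computable_cong: "computable D \<phi> \<Longrightarrow> (\<And>i. i < D \<Longrightarrow> r i = r' i) \<Longrightarrow> \<phi> \<sigma> r = \<phi> \<sigma> r'"
  unfolding computable_def by blast

lemma computable_program:
  "computable D \<phi> \<Longrightarrow> D \<le> d \<Longrightarrow> \<exists>c T. poly_time T \<and> computes d c \<phi> T"
  unfolding computable_def by blast

lemma computable_mono: "computable D \<phi> \<Longrightarrow> D \<le> E \<Longrightarrow> computable E \<phi>"
  unfolding computable_def by (meson less_le_trans order_trans)

abbreviation reg :: "nat \<Rightarrow> aexp" where "reg k \<equiv> Cell ''m'' (Num k)"
abbreviation set_reg :: "nat \<Rightarrow> aexp \<Rightarrow> com" where "set_reg k a \<equiv> Store ''m'' (Num k) a"

lemma exec_set_reg: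
  "exec (set_reg k a) (\<sigma>(''m'' := r)) (acost a + 2)
     (\<sigma>(''m'' := r(k := aval a (\<sigma>(''m'' := r)))))"
  using exec.Store[of "''m''" "Num k" a "\<sigma>(''m'' := r)"] by simp

lemma computable_aexp:
  assumes "\<And>\<sigma> r. aval a (\<sigma>(''m'' := r)) = \<phi> \<sigma> r"
    and "\<And>\<sigma> r r'. (\<And>i. i < D \<Longrightarrow> r i = r' i) \<Longrightarrow> \<phi> \<sigma> r = \<phi> \<sigma> r'"
  shows "computable D \<phi>"
proof -
  have "computes d (set_reg d a) \<phi> (\<lambda>_. acost a + 2)" if "D \<le> d" for d
    unfolding computes_def
  proof (intro allI)
    fix \<sigma> :: state and r
    show "\<exists>t r'. exec (set_reg d a) (\<sigma>(''m'' := r)) t (\<sigma>(''m'' := r')) \<and>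
        t \<le> acost a + 2 \<and> r' d = \<phi> \<sigma> r \<and> (\<forall>i<d. r' i = r i)"
      by (intro exI conjI, rule exec_set_reg) (auto simp: assms(1))
  qed
  moreover have "\<phi> \<sigma> r = \<phi> \<sigma> r'" if "\<forall>i<D. r i = r' i" for \<sigma> r r'
    by (rule assms(2)) (use that in simp)
  ultimately show ?thesis
    unfolding computable_def using poly_time_const[of "acost a + 2"]
    by (intro conjI allI impI) (assumption, meson)
qed

lemma computable_const: "computable D (\<lambda>_ _. k)"
  by (rule computable_aexp[where a = "Num k"]) auto

lemma computable_reg: "k < D \<Longrightarrow> computable D (\<lambda>_ r. r k)"
  by (rule computable_aexp[where a = "reg k"]) auto

lemma computable_q: "computable D (\<lambda>\<sigma> _. \<sigma> ''q'' 0)"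
  by (rule computable_aexp[where a = "Cell ''q'' (Num 0)"]) auto

lemma computable_n: "computable D (\<lambda>\<sigma> _. \<sigma> ''n'' 0)"
  by (rule computable_aexp[where a = "Cell ''n'' (Num 0)"]) auto

text \<open>The first value stays in register \<open>d\<close> while the second program, whose
  target is \<open>Suc d\<close>, preserves everything below its target. That program starts from
  registers that \<open>c1\<close> may have changed from \<open>d\<close> on; by \<open>ext\<close>
  this does not alter the value of \<open>\<psi>\<close>.\<close>

lemma computes_binop:
  assumes op: "\<And>\<sigma> r. aval (a d) (\<sigma>(''m'' := r)) = h \<sigma> (r d) (r (Suc d))"
  assumes "computes d c1 \<phi> T1" "computes (Suc d) c2 \<psi> T2"
    and ext: "\<And>\<sigma> r r'. (\<And>i. i < d \<Longrightarrow> r i = r' i) \<Longrightarrow> \<psi> \<sigma> r = \<psi> \<sigma> r'"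
  shows "computes d (Seq c1 (Seq c2 (set_reg d (a d)))) (\<lambda>\<sigma> r. h \<sigma> (\<phi> \<sigma> r) (\<psi> \<sigma> r))
    (\<lambda>\<sigma>. T1 \<sigma> + (T2 \<sigma> + (acost (a d) + 2)))"
  unfolding computes_def
proof (intro allI)
  fix \<sigma> :: state and r
  obtain t1 r1 where 1: "exec c1 (\<sigma>(''m'' := r)) t1 (\<sigma>(''m'' := r1))" "t1 \<le> T1 \<sigma>"
    "r1 d = \<phi> \<sigma> r" "\<forall>i<d. r1 i = r i"
    using assms(2) unfolding computes_def by blast
  obtain t2 r2 where 2: "exec c2 (\<sigma>(''m'' := r1)) t2 (\<sigma>(''m'' := r2))" "t2 \<le> T2 \<sigma>"
    "r2 (Suc d) = \<psi> \<sigma> r1" "\<forall>i<Suc d. r2 i = r1 i"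
    using assms(3) unfolding computes_def by blast
  have e: "\<psi> \<sigma> r1 = \<psi> \<sigma> r" by (rule ext) (use 1 in auto)
  show "\<exists>t r'. exec (Seq c1 (Seq c2 (set_reg d (a d)))) (\<sigma>(''m'' := r)) t (\<sigma>(''m'' := r')) \<and>
      t \<le> T1 \<sigma> + (T2 \<sigma> + (acost (a d) + 2)) \<and> r' d = h \<sigma> (\<phi> \<sigma> r) (\<psi> \<sigma> r) \<and> (\<forall>i<d. r' i = r i)"
    by (intro exI conjI, rule exec.Seq[OF 1(1) exec.Seq[OF 2(1) exec_set_reg]])
      (use 1 2 e in \<open>auto simp: op\<close>)
qed

lemma computable_op:
  assumes "\<And>\<sigma> r d. aval (a d) (\<sigma>(''m'' := r)) = h \<sigma> (r d) (r (Suc d))"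
  assumes \<phi>: "computable D \<phi>" and \<psi>: "computable D \<psi>"
  shows "computable D (\<lambda>\<sigma> r. h \<sigma> (\<phi> \<sigma> r) (\<psi> \<sigma> r))"
  unfolding computable_def
proof (intro conjI allI impI)
  fix \<sigma> :: state and r r' :: "nat \<Rightarrow> nat" assume "\<forall>i<D. r i = r' i"
  then show "h \<sigma> (\<phi> \<sigma> r) (\<psi> \<sigma> r) = h \<sigma> (\<phi> \<sigma> r') (\<psi> \<sigma> r')"
    using computable_cong[OF \<phi>, of r r' \<sigma>] computable_cong[OF \<psi>, of r r' \<sigma>] by simp
next
  fix d assume d: "D \<le> d"
  obtain c1 T1 where 1: "poly_time T1" "computes d c1 \<phi> T1"
    using computable_program[OF \<phi> d] by blast
  obtain c2 T2 where 2: "poly_time T2" "computes (Suc d) c2 \<psi> T2"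
    using computable_program[OF \<psi>, of "Suc d"] d by auto
  have "computes d (Seq c1 (Seq c2 (set_reg d (a d)))) (\<lambda>\<sigma> r. h \<sigma> (\<phi> \<sigma> r) (\<psi> \<sigma> r))
    (\<lambda>\<sigma>. T1 \<sigma> + (T2 \<sigma> + (acost (a d) + 2)))"
    by (rule computes_binop[where h = h and a = a, OF assms(1) 1(2) 2(2)], rule computable_cong[OF \<psi>])
      (use d in auto)
  moreover have "poly_time (\<lambda>\<sigma>. T1 \<sigma> + (T2 \<sigma> + (acost (a d) + 2)))"
    by (intro poly_time_intros 1 2)
  ultimately show "\<exists>c T. poly_time T \<and> computes d c (\<lambda>\<sigma> r. h \<sigma> (\<phi> \<sigma> r) (\<psi> \<sigma> r)) T"
    by blast
qed

lemma computable_add: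
  "computable D \<phi> \<Longrightarrow> computable D \<psi> \<Longrightarrow> computable D (\<lambda>\<sigma> r. \<phi> \<sigma> r + \<psi> \<sigma> r)"
  by (rule computable_op[where h = "\<lambda>_ x y. x + y" and a = "\<lambda>d. Plus (reg d) (reg (Suc d))"]) auto

lemma computable_diff:
  "computable D \<phi> \<Longrightarrow> computable D \<psi> \<Longrightarrow> computable D (\<lambda>\<sigma> r. \<phi> \<sigma> r - \<psi> \<sigma> r)"
  by (rule computable_op[where h = "\<lambda>_ x y. x - y" and a = "\<lambda>d. Minus (reg d) (reg (Suc d))"]) auto

text \<open>Memory access is treated as a binary operation that ignores its second operand; this is
  why \<open>h\<close> in \<open>computable_op\<close> also receives the state. The array
  \<open>m\<close> is excluded because it holds the registers instead of input.\<close>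

lemma computable_read:
  "X \<noteq> ''m'' \<Longrightarrow> computable D \<phi> \<Longrightarrow> computable D (\<lambda>\<sigma> r. \<sigma> X (\<phi> \<sigma> r))"
  by (rule computable_op[where h = "\<lambda>\<sigma> x y. \<sigma> X x" and a = "\<lambda>d. Cell X (reg d)"]) auto

text \<open>Register \<open>d\<close> counts the remaining rounds down, \<open>d + 1\<close> holds
  the round number, \<open>d + 2\<close> the accumulator, and \<open>d + 3\<close> receives the
  value of the body. Besides the body, a round costs 3 for the guard and 4 + 6 + 6 for the updates,
  hence 19; the final 3 is the failing guard. An arbitrary starting round \<open>k\<close> makes the
  induction on the remaining rounds possible.\<close>

lemma exec_fold_loop:
  fixes \<sigma> :: state
  assumes body: "computes (d + 3) c (\<lambda>\<sigma> r. B \<sigma> r (r (d + 1)) (r (d + 2))) T"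
    and ext: "\<And>\<sigma> r r' k a. (\<And>i. i < d \<Longrightarrow> r i = r' i) \<Longrightarrow> B \<sigma> r k a = B \<sigma> r' k a"
  defines "w \<equiv> While (reg d) (Seq c (Seq (set_reg (d + 2) (reg (d + 3)))
    (Seq (set_reg (d + 1) (Plus (reg (d + 1)) (Num 1))) (set_reg d (Minus (reg d) (Num 1))))))"
  shows "r d = m \<Longrightarrow> r (d + 1) = k \<Longrightarrow> r (d + 2) = rec_nat a (B \<sigma> r) k \<Longrightarrow>
    \<exists>t r'. exec w (\<sigma>(''m'' := r)) t (\<sigma>(''m'' := r')) \<and> t \<le> m * (T \<sigma> + 19) + 3 \<and>
      r' (d + 2) = rec_nat a (B \<sigma> r) (k + m) \<and> (\<forall>i<d. r' i = r i)"
proof (induction m arbitrary: r k)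
  case 0
  have "exec w (\<sigma>(''m'' := r)) (acost (reg d) + 1) (\<sigma>(''m'' := r))"
    unfolding w_def by (rule exec.WhileFalse) (use 0 in simp)
  moreover have "acost (reg d) + 1 \<le> 0 * (T \<sigma> + 19) + 3" by simp
  ultimately show ?case using 0(3) by (metis add.right_neutral)
next
  case (Suc m)
  obtain t1 r1 where 1: "exec c (\<sigma>(''m'' := r)) t1 (\<sigma>(''m'' := r1))" "t1 \<le> T \<sigma>"
    "r1 (d + 3) = B \<sigma> r (r (d + 1)) (r (d + 2))" "\<forall>i<d + 3. r1 i = r i"
    using body unfolding computes_def by blast
  define r2 where "r2 = r1(d + 2 := r1 (d + 3), d + 1 := Suc k, d := m)"
  have r1: "r1 d = Suc m" "r1 (d + 1) = k" "r1 (d + 2) = r (d + 2)" using 1(4) Suc.prems by auto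
  have B: "B \<sigma> r2 = B \<sigma> r"
    by (intro ext[THEN HOL.ext[THEN HOL.ext]]) (use 1(4) in \<open>auto simp: r2_def\<close>)
  have 3: "r2 d = m" "r2 (d + 1) = Suc k" "r2 (d + 2) = rec_nat a (B \<sigma> r2) (Suc k)"
    using Suc.prems 1(3) unfolding B by (simp_all add: r2_def)
  have e: "exec (Seq (set_reg (d + 2) (reg (d + 3)))
    (Seq (set_reg (d + 1) (Plus (reg (d + 1)) (Num 1))) (set_reg d (Minus (reg d) (Num 1)))))
    (\<sigma>(''m'' := r1)) (4 + (6 + 6)) (\<sigma>(''m'' := r2))"
  proof -
    have "exec (set_reg (d + 2) (reg (d + 3))) (\<sigma>(''m'' := r1)) 4
       (\<sigma>(''m'' := r1(d + 2 := r1 (d + 3))))"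
      using exec_set_reg[of "d + 2" "reg (d + 3)" \<sigma> r1] by (simp add: eval_nat_numeral)
    moreover have "exec (set_reg (d + 1) (Plus (reg (d + 1)) (Num 1)))
       (\<sigma>(''m'' := r1(d + 2 := r1 (d + 3)))) 6
       (\<sigma>(''m'' := r1(d + 2 := r1 (d + 3), d + 1 := Suc k)))"
      using exec_set_reg[of "d + 1" "Plus (reg (d + 1)) (Num 1)" \<sigma> "r1(d + 2 := r1 (d + 3))"] r1
      by (simp add: eval_nat_numeral)
    moreover have "exec (set_reg d (Minus (reg d) (Num 1)))
       (\<sigma>(''m'' := r1(d + 2 := r1 (d + 3), d + 1 := Suc k))) 6 (\<sigma>(''m'' := r2))"
      using exec_set_reg[of d "Minus (reg d) (Num 1)" \<sigma>
          "r1(d + 2 := r1 (d + 3), d + 1 := Suc k)"] r1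
      by (simp add: r2_def eval_nat_numeral)
    ultimately show ?thesis by (intro exec.Seq)
  qed
  obtain t2 r3 where 4: "exec w (\<sigma>(''m'' := r2)) t2 (\<sigma>(''m'' := r3))" "t2 \<le> m * (T \<sigma> + 19) + 3"
    "r3 (d + 2) = rec_nat a (B \<sigma> r2) (Suc k + m)" "\<forall>i<d. r3 i = r2 i"
    using Suc.IH[OF 3] by blast
  have "exec w (\<sigma>(''m'' := r)) (acost (reg d) + 1 + (t1 + (4 + (6 + 6))) + t2) (\<sigma>(''m'' := r3))"
    unfolding w_def
    by (rule exec.WhileTrue[OF _ exec.Seq[OF 1(1) e] 4(1)[unfolded w_def]]) (use Suc.prems in simp)
  moreover have "acost (reg d) + 1 + (t1 + (4 + (6 + 6))) + t2 \<le> Suc m * (T \<sigma> + 19) + 3"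
    using 1(2) 4(2) by simp
  moreover have "r3 (d + 2) = rec_nat a (B \<sigma> r) (k + Suc m)" using 4(3) B by simp
  moreover have "\<forall>i<d. r3 i = r i" using 4(4) 1(4) by (auto simp: r2_def)
  ultimately show ?case by blast
qed

text \<open>In the assumption on the body, registers for \<open>\<kappa>\<close> and \<open>\<alpha>\<close> give the program of the loop body, while
  constants show that the body depends on no other register from \<open>D\<close> on.\<close>

lemma computable_fold:
  assumes b: "computable D b" and i: "computable D i"
    and body: "\<And>E \<kappa> \<alpha>. D \<le> E \<Longrightarrow> computable E \<kappa> \<Longrightarrow> computable E \<alpha> \<Longrightarrow>
      computable E (\<lambda>\<sigma> r. B \<sigma> r (\<kappa> \<sigma> r) (\<alpha> \<sigma> r))"
    and bounded: "poly_bounded b"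
  shows "computable D (\<lambda>\<sigma> r. rec_nat (i \<sigma> r) (B \<sigma> r) (b \<sigma> r))"
proof -
  have ext: "B \<sigma> r k a = B \<sigma> r' k a" if "\<And>i. i < D \<Longrightarrow> r i = r' i" for \<sigma> r r' k a
    using computable_cong[OF body[OF order.refl computable_const computable_const], of r r' \<sigma> k a] that
    by simp
  obtain S where S: "poly_time S" "\<And>\<sigma> r. b \<sigma> r \<le> S \<sigma>"
    using bounded unfolding poly_bounded_def by blast
  show ?thesis
    unfolding computable_def
  proof (intro conjI allI impI)
    fix \<sigma> :: state and r r' :: "nat \<Rightarrow> nat" assume r: "\<forall>i<D. r i = r' i"
    have "B \<sigma> r = B \<sigma> r'" by (intro HOL.ext ext) (use r in auto)
    then show "rec_nat (i \<sigma> r) (B \<sigma> r) (b \<sigma> r) = rec_nat (i \<sigma> r') (B \<sigma> r') (b \<sigma> r')"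
      using r computable_cong[OF b, of r r' \<sigma>] computable_cong[OF i, of r r' \<sigma>] by simp
  next
    fix d assume d: "D \<le> d"
    obtain c1 T1 where 1: "poly_time T1" "computes d c1 b T1"
      using computable_program[OF b d] by blast
    obtain c2 T2 where 2: "poly_time T2" "computes (d + 2) c2 i T2"
      using computable_program[OF i, of "d + 2"] d by auto
    obtain c T where 3: "poly_time T"
      "computes (d + 3) c (\<lambda>\<sigma> r. B \<sigma> r (r (d + 1)) (r (d + 2))) T"
      using computable_program[OF body[OF _ computable_reg[of "d + 1" "d + 3"]
          computable_reg[of "d + 2" "d + 3"]] order.refl] d by auto
    have extd: "\<And>\<sigma> r r' k a. (\<And>i. i < d \<Longrightarrow> r i = r' i) \<Longrightarrow> B \<sigma> r k a = B \<sigma> r' k a"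
      using ext d by (meson less_le_trans)
    define w where "w = While (reg d) (Seq c (Seq (set_reg (d + 2) (reg (d + 3)))
      (Seq (set_reg (d + 1) (Plus (reg (d + 1)) (Num 1))) (set_reg d (Minus (reg d) (Num 1))))))"
    \<comment> \<open>The initial value is computed with target \<open>d + 2\<close> after the bound
      and the counter have been stored in \<open>d\<close> and \<open>d + 1\<close>, so both
      survive.\<close>
    define p where "p = Seq c1 (Seq (set_reg (d + 1) (Num 0)) (Seq c2 (Seq w (set_reg d (reg (d + 2))))))"
    define T' where "T' = (\<lambda>\<sigma>. T1 \<sigma> + (3 + (T2 \<sigma> + (S \<sigma> * (T \<sigma> + 19) + 3 + 4))))"
    have "computes d p (\<lambda>\<sigma> r. rec_nat (i \<sigma> r) (B \<sigma> r) (b \<sigma> r)) T'"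
      unfolding computes_def
    proof (intro allI)
      fix \<sigma> :: state and r
      obtain t1 r1 where r1: "exec c1 (\<sigma>(''m'' := r)) t1 (\<sigma>(''m'' := r1))" "t1 \<le> T1 \<sigma>"
        "r1 d = b \<sigma> r" "\<forall>i<d. r1 i = r i"
        using 1(2) unfolding computes_def by blast
      define r2 where "r2 = r1(d + 1 := 0)"
      have e2: "exec (set_reg (d + 1) (Num 0)) (\<sigma>(''m'' := r1)) 3 (\<sigma>(''m'' := r2))"
        using exec_set_reg[of "d + 1" "Num 0" \<sigma> r1] by (simp add: r2_def eval_nat_numeral)
      obtain t3 r3 where r3: "exec c2 (\<sigma>(''m'' := r2)) t3 (\<sigma>(''m'' := r3))" "t3 \<le> T2 \<sigma>"
        "r3 (d + 2) = i \<sigma> r2" "\<forall>i<d + 2. r3 i = r2 i"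
        using 2(2) unfolding computes_def by blast
      have i': "i \<sigma> r2 = i \<sigma> r" by (rule computable_cong[OF i]) (use r1 d in \<open>auto simp: r2_def\<close>)
      have B: "B \<sigma> r3 = B \<sigma> r"
        by (intro extd[THEN HOL.ext[THEN HOL.ext]]) (use r1(4) r3(4) in \<open>auto simp: r2_def\<close>)
      have "r3 d = b \<sigma> r" "r3 (d + 1) = 0" "r3 (d + 2) = rec_nat (i \<sigma> r) (B \<sigma> r3) 0"
        using r1(3) r3 i' by (auto simp: r2_def)
      from exec_fold_loop[where B = B, OF 3(2) extd this] obtain t4 r4 where
        r4: "exec w (\<sigma>(''m'' := r3)) t4 (\<sigma>(''m'' := r4))" "t4 \<le> b \<sigma> r * (T \<sigma> + 19) + 3"
        "r4 (d + 2) = rec_nat (i \<sigma> r) (B \<sigma> r3) (0 + b \<sigma> r)" "\<forall>i<d. r4 i = r3 i"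
        unfolding w_def by blast
      have e5: "exec (set_reg d (reg (d + 2))) (\<sigma>(''m'' := r4)) 4 (\<sigma>(''m'' := r4(d := r4 (d + 2))))"
        using exec_set_reg[of d "reg (d + 2)" \<sigma> r4] by (simp add: eval_nat_numeral)
      have "b \<sigma> r * (T \<sigma> + 19) \<le> S \<sigma> * (T \<sigma> + 19)" using S(2) by (rule mult_right_mono) simp
      then have "t1 + (3 + (t3 + (t4 + 4))) \<le> T' \<sigma>"
        using r1(2) r3(2) r4(2) unfolding T'_def by linarith
      moreover have "exec p (\<sigma>(''m'' := r)) (t1 + (3 + (t3 + (t4 + 4))))
          (\<sigma>(''m'' := r4(d := r4 (d + 2))))"
        unfolding p_def 
        by (rule exec.Seq[OF r1(1) exec.Seq[OF e2 exec.Seq[OF r3(1) exec.Seq[OF r4(1) e5]]]])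
      moreover have "\<forall>i<d. (r4(d := r4 (d + 2))) i = r i"
        using r1(4) r3(4) r4(4) by (auto simp: r2_def)
      ultimately show "\<exists>t r'. exec p (\<sigma>(''m'' := r)) t (\<sigma>(''m'' := r')) \<and> t \<le> T' \<sigma> \<and>
          r' d = rec_nat (i \<sigma> r) (B \<sigma> r) (b \<sigma> r) \<and> (\<forall>i<d. r' i = r i)"
        using r4(3) B by (intro exI[of _ "t1 + (3 + (t3 + (t4 + 4)))"] exI[of _ "r4(d := r4 (d + 2))"]) simp
    qed
    moreover have "poly_time T'" unfolding T'_def by (intro poly_time_intros 1 2 3 S)
    ultimately show "\<exists>c T. poly_time T \<and> computes d c (\<lambda>\<sigma> r. rec_nat (i \<sigma> r) (B \<sigma> r) (b \<sigma> r)) T"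
      by blast
  qed
qed

section \<open>Predicates, arithmetic and exhaustive search as bounded loops\<close>

definition decidable :: "nat \<Rightarrow> (state \<Rightarrow> (nat \<Rightarrow> nat) \<Rightarrow> bool) \<Rightarrow> bool" where
  "decidable D P \<longleftrightarrow> computable D (\<lambda>\<sigma> r. of_bool (P \<sigma> r))"

lemma poly_bounded_poly_time: "poly_time S \<Longrightarrow> poly_bounded (\<lambda>\<sigma> _. S \<sigma>)"
  unfolding poly_bounded_def by blast

lemmas poly_bounded_input = poly_time_q[THEN poly_bounded_poly_time]
  poly_time_n[THEN poly_bounded_poly_time] poly_time_q_power_n[THEN poly_bounded_poly_time]

lemma poly_bounded_mono:
  "poly_bounded b \<Longrightarrow> (\<And>\<sigma> r. a \<sigma> r \<le> b \<sigma> r) \<Longrightarrow> poly_bounded a"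
  unfolding poly_bounded_def by (meson order_trans)

lemma poly_bounded_min: "poly_bounded b \<Longrightarrow> poly_bounded (\<lambda>\<sigma> r. min (a \<sigma> r) (b \<sigma> r))"
  by (erule poly_bounded_mono) simp

lemma poly_bounded_div: "poly_bounded a \<Longrightarrow> poly_bounded (\<lambda>\<sigma> r. a \<sigma> r div b \<sigma> r)"
  by (erule poly_bounded_mono) simp

lemma poly_bounded_of_bool: "poly_bounded (\<lambda>\<sigma> r. of_bool (P \<sigma> r))"
  by (rule poly_bounded_mono[OF poly_bounded_poly_time[OF poly_time_const[of 1]]]) simp

lemma poly_bounded_q_power_min: "poly_bounded (\<lambda>\<sigma> r. \<sigma> ''q'' 0 ^ min (a \<sigma> r) (\<sigma> ''n'' 0))"
proof (rule poly_bounded_mono[where b = "\<lambda>\<sigma> _. input_size \<sigma>"])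
  have "poly_time input_size" unfolding poly_time_def by (rule exI[of _ 1]) simp
  then show "poly_bounded (\<lambda>\<sigma> _. input_size \<sigma>)" by (rule poly_bounded_poly_time)
  fix \<sigma> :: state and r
  have "\<sigma> ''q'' 0 ^ min (a \<sigma> r) (\<sigma> ''n'' 0) \<le> (\<sigma> ''q'' 0 + 2) ^ min (a \<sigma> r) (\<sigma> ''n'' 0)"
    by (rule power_mono) auto
  also have "\<dots> \<le> input_size \<sigma>" unfolding input_size_def by (rule power_increasing) auto
  finally show "\<sigma> ''q'' 0 ^ min (a \<sigma> r) (\<sigma> ''n'' 0) \<le> input_size \<sigma>" .
qed

lemmas poly_bounded_intros = poly_bounded_input poly_bounded_min poly_bounded_div
  poly_bounded_of_bool poly_bounded_q_power_min

text \<open>Truncated subtraction computes truth values: \<open>x - y\<close> is 0 exactly if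
  \<open>x \<le> y\<close>. Negation and conjunction use it in the same way.\<close>

lemma decidable_le:
  assumes "computable D a" "computable D b"
  shows "decidable D (\<lambda>\<sigma> r. a \<sigma> r \<le> b \<sigma> r)"
proof -
  have "of_bool (x \<le> y) = (1::nat) - (x - y)" for x y :: nat by auto
  then show ?thesis
    unfolding decidable_def by (auto intro!: computable_diff computable_const assms)
qed

lemma decidable_not:
  assumes "decidable D P"
  shows "decidable D (\<lambda>\<sigma> r. \<not> P \<sigma> r)"
proof -
  have "of_bool (\<not> A) = (1::nat) - of_bool A" for A by simp
  then show ?thesis
    using assms unfolding decidable_def by (simp only:) (intro computable_diff computable_const)
qed

lemma decidable_conj:
  assumes "decidable D P" "decidable D Q"
  shows "decidable D (\<lambda>\<sigma> r. P \<sigma> r \<and> Q \<sigma> r)"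
proof -
  have "of_bool (A \<and> B) = (1::nat) - ((1 - of_bool A) + (1 - of_bool B))" for A B by auto
  then show ?thesis
    using assms unfolding decidable_def
    by (simp only:) (intro computable_diff computable_add computable_const)
qed

lemma decidable_imp:
  "decidable D P \<Longrightarrow> decidable D Q \<Longrightarrow> decidable D (\<lambda>\<sigma> r. P \<sigma> r \<longrightarrow> Q \<sigma> r)"
  using decidable_not[OF decidable_conj[OF _ decidable_not], of D P Q] by simp

lemma decidable_eq:
  assumes "computable D a" "computable D b"
  shows "decidable D (\<lambda>\<sigma> r. a \<sigma> r = b \<sigma> r)"
  unfolding order_eq_iff by (intro decidable_conj decidable_le assms)

text \<open>A conditional is a loop whose number of rounds is the truth value of its guard.\<close>

lemma computable_if:
  assumes P: "decidable D P" and a: "computable D a" and b: "computable D b"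
  shows "computable D (\<lambda>\<sigma> r. if P \<sigma> r then a \<sigma> r else b \<sigma> r)"
proof -
  have "computable D (\<lambda>\<sigma> r. rec_nat (b \<sigma> r) (\<lambda>_ _. a \<sigma> r) (of_bool (P \<sigma> r)))"
    by (rule computable_fold[OF P[unfolded decidable_def] b])
      (auto intro: computable_mono[OF a] poly_bounded_of_bool)
  moreover have "rec_nat y (\<lambda>_ _. x) (of_bool A) = (if A then x else y)" for x y :: nat and A
    by simp
  ultimately show ?thesis by (simp only:)
qed

lemma decidable_ball:
  assumes b: "computable D b" "poly_bounded b"
    and P: "\<And>E \<kappa>. D \<le> E \<Longrightarrow> computable E \<kappa> \<Longrightarrow> decidable E (\<lambda>\<sigma> r. P \<sigma> r (\<kappa> \<sigma> r))"
  shows "decidable D (\<lambda>\<sigma> r. \<forall>x<b \<sigma> r. P \<sigma> r x)"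
proof -
  have "computable D (\<lambda>\<sigma> r. rec_nat 1 (\<lambda>k a. if P \<sigma> r k then a else 0) (b \<sigma> r))"
    by (rule computable_fold[OF b(1) computable_const])
      (auto intro: computable_if computable_const P b)
  moreover have "rec_nat 1 (\<lambda>k a. if A k then a else 0) m = (of_bool (\<forall>x<m. A x) :: nat)" for A m
    by (induction m) (auto simp: less_Suc_eq)
  ultimately show ?thesis unfolding decidable_def by (simp only:)
qed

lemma decidable_bex:
  assumes b: "computable D b" "poly_bounded b"
    and P: "\<And>E \<kappa>. D \<le> E \<Longrightarrow> computable E \<kappa> \<Longrightarrow> decidable E (\<lambda>\<sigma> r. P \<sigma> r (\<kappa> \<sigma> r))"
  shows "decidable D (\<lambda>\<sigma> r. \<exists>x<b \<sigma> r. P \<sigma> r x)"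
proof -
  have "decidable D (\<lambda>\<sigma> r. \<not> (\<forall>x<b \<sigma> r. \<not> P \<sigma> r x))"
    by (intro decidable_not decidable_ball b P)
  then show ?thesis by simp
qed

text \<open>Repeated addition. Only the second factor is a loop count and has to be bounded, which
  makes the order of factors matter.\<close>

lemma computable_mult:
  assumes a: "computable D a" and b: "computable D b" "poly_bounded b"
  shows "computable D (\<lambda>\<sigma> r. a \<sigma> r * b \<sigma> r)"
proof -
  have "computable D (\<lambda>\<sigma> r. rec_nat 0 (\<lambda>_ c. c + a \<sigma> r) (b \<sigma> r))"
    by (rule computable_fold[OF b(1) computable_const])
      (auto intro: computable_add computable_mono[OF a] b)
  moreover have "rec_nat 0 (\<lambda>_ c. c + x) m = x * m" for x m :: nat
    by (induction m) auto
  ultimately show ?thesis by (simp only:)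
qed

lemma computable_power:
  assumes a: "computable D a" "poly_bounded a" and b: "computable D b" "poly_bounded b"
  shows "computable D (\<lambda>\<sigma> r. a \<sigma> r ^ b \<sigma> r)"
proof -
  have "computable D (\<lambda>\<sigma> r. rec_nat 1 (\<lambda>_ c. c * a \<sigma> r) (b \<sigma> r))"
    by (rule computable_fold[OF b(1) computable_const])
      (auto intro: computable_mult computable_mono[OF a(1)] a b)
  moreover have "rec_nat 1 (\<lambda>_ c. c * x) m = x ^ m" for x m :: nat
    by (induction m) auto
  ultimately show ?thesis by (simp only:)
qed

text \<open>The quotient is the number of \<open>k\<close> below \<open>a\<close> with
  \<open>(k + 1) * b \<le> a\<close>: after \<open>m\<close> rounds the count is
  \<open>min m (a div b)\<close>, and \<open>a div b \<le> a\<close>. Excluding \<open>b = 0\<close>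
  in the test reproduces the convention that division by 0 gives 0.\<close>

lemma computable_div:
  assumes a: "computable D a" "poly_bounded a" and b: "computable D b" "poly_bounded b"
  shows "computable D (\<lambda>\<sigma> r. a \<sigma> r div b \<sigma> r)"
proof -
  let ?h = "\<lambda>x y k c. c + of_bool (\<not> y \<le> 0 \<and> (k + 1) * y \<le> (x::nat))"
  have "computable D (\<lambda>\<sigma> r. rec_nat 0 (?h (a \<sigma> r) (b \<sigma> r)) (a \<sigma> r))"
  proof (rule computable_fold[OF a(1) computable_const _ a(2)])
    fix E and \<kappa> \<alpha> :: "state \<Rightarrow> (nat \<Rightarrow> nat) \<Rightarrow> nat"
    assume E: "D \<le> E" "computable E \<kappa>" "computable E \<alpha>"
    note a' = computable_mono[OF a(1) E(1)] and b' = computable_mono[OF b(1) E(1)]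
    have "decidable E (\<lambda>\<sigma> r. \<not> b \<sigma> r \<le> 0 \<and> (\<kappa> \<sigma> r + 1) * b \<sigma> r \<le> a \<sigma> r)"
      by (intro decidable_conj decidable_not decidable_le computable_mult computable_add
          computable_const a' b' b(2) E)
    then show "computable E (\<lambda>\<sigma> r. ?h (a \<sigma> r) (b \<sigma> r) (\<kappa> \<sigma> r) (\<alpha> \<sigma> r))"
      unfolding decidable_def by (intro computable_add E(3))
  qed
  moreover have "rec_nat 0 (?h x y) x = x div y" for x y :: nat
  proof -
    have "rec_nat 0 (?h x y) m = min m (x div y)" for m
    proof (induction m)
      case (Suc m)
      show ?case
      proof (cases "y = 0")
        case False
        then have "(m + 1) * y \<le> x \<longleftrightarrow> m + 1 \<le> x div y"
          by (metis less_eq_div_iff_mult_less_eq not_gr_zero)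
        then show ?thesis using Suc False by (auto simp: min_def)
      qed (use Suc in simp)
    qed simp
    then show ?thesis by simp
  qed
  ultimately show ?thesis by (simp only:)
qed

lemma computable_mod:
  assumes a: "computable D a" "poly_bounded a" and b: "computable D b" "poly_bounded b"
  shows "computable D (\<lambda>\<sigma> r. a \<sigma> r mod b \<sigma> r)"
  unfolding minus_div_mult_eq_mod[symmetric]
  by (intro computable_diff computable_mult computable_div a b)

lemma computable_min:
  assumes "computable D a" "computable D b"
  shows "computable D (\<lambda>\<sigma> r. min (a \<sigma> r) (b \<sigma> r))"
  unfolding min_def by (intro computable_if decidable_le assms)

text \<open>The largest witness below \<open>m\<close>, or 0 if there is none: a single fold without
  early exit. It is only evaluated further where the witness is unique.\<close>

definition search :: "nat \<Rightarrow> (nat \<Rightarrow> bool) \<Rightarrow> nat" where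
  "search m P = rec_nat 0 (\<lambda>x a. if P x then x else a) m"

lemma search_unique: "x < m \<Longrightarrow> P x \<Longrightarrow> (\<And>y. y < m \<Longrightarrow> P y \<Longrightarrow> y = x) \<Longrightarrow> search m P = x"
proof (induction m)
  case (Suc m)
  show ?case
  proof (cases "P m")
    case True
    then show ?thesis using Suc.prems(3)[of m] by (simp add: search_def)
  next
    case False
    then have "x < m" using Suc.prems by (metis less_Suc_eq)
    then have "search m P = x" by (rule Suc.IH[OF _ Suc.prems(2) Suc.prems(3)[OF less_SucI]])
    then show ?thesis using False by (simp add: search_def)
  qed
qed simp

lemma computable_search:
  assumes b: "computable D b" "poly_bounded b"
    and P: "\<And>E \<kappa>. D \<le> E \<Longrightarrow> computable E \<kappa> \<Longrightarrow> decidable E (\<lambda>\<sigma> r. P \<sigma> r (\<kappa> \<sigma> r))"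
  shows "computable D (\<lambda>\<sigma> r. search (b \<sigma> r) (P \<sigma> r))"
  unfolding search_def
  by (rule computable_fold[OF b(1) computable_const]) (auto intro: computable_if P b)

section \<open>The algorithm\<close>

abbreviation codes :: "state \<Rightarrow> nat" where
  "codes \<sigma> \<equiv> \<sigma> ''q'' 0 ^ \<sigma> ''n'' 0"

definition field_add :: "state \<Rightarrow> nat \<Rightarrow> nat \<Rightarrow> nat" where
  "field_add \<sigma> x y = \<sigma> ''add'' (x * \<sigma> ''q'' 0 + y)"

definition field_mult :: "state \<Rightarrow> nat \<Rightarrow> nat \<Rightarrow> nat" where
  "field_mult \<sigma> x y = \<sigma> ''mul'' (x * \<sigma> ''q'' 0 + y)"

text \<open>The zero of the field need not be the number \<open>0\<close>.\<close>

definition field_zero :: "state \<Rightarrow> nat" where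
  "field_zero \<sigma> = search (\<sigma> ''q'' 0) (\<lambda>z. field_add \<sigma> z z = z)"

definition field_sum :: "state \<Rightarrow> (nat \<Rightarrow> nat) \<Rightarrow> nat" where
  "field_sum \<sigma> h = rec_nat (field_zero \<sigma>) (\<lambda>i a. field_add \<sigma> a (h i)) (\<sigma> ''n'' 0)"

text \<open>A vector is coded by the number below \<open>q\<^sup>n\<close> that has its entries as base \<open>q\<close> digits.
  The minima only serve to bound the running time uniformly.\<close>

definition digit :: "state \<Rightarrow> nat \<Rightarrow> nat \<Rightarrow> nat" where
  "digit \<sigma> x i = (min x (codes \<sigma>) div \<sigma> ''q'' 0 ^ min i (\<sigma> ''n'' 0)) mod \<sigma> ''q'' 0"

definition form_value :: "vname \<Rightarrow> state \<Rightarrow> nat \<Rightarrow> nat \<Rightarrow> nat \<Rightarrow> nat" where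
  "form_value X \<sigma> x y z =
     field_sum \<sigma> (\<lambda>i. field_sum \<sigma> (\<lambda>j. field_sum \<sigma> (\<lambda>k.
       field_mult \<sigma> (field_mult \<sigma> (field_mult \<sigma>
         (\<sigma> X ((i * \<sigma> ''n'' 0 + j) * \<sigma> ''n'' 0 + k)) (digit \<sigma> x i)) (digit \<sigma> y j)) (digit \<sigma> z k))))"

definition chain_step :: "vname \<Rightarrow> state \<Rightarrow> nat \<Rightarrow> nat \<Rightarrow> nat \<Rightarrow> nat" where
  "chain_step X \<sigma> x1 x2 u = search (codes \<sigma>)
     (\<lambda>w. \<forall>y<codes \<sigma>. form_value X \<sigma> x1 y w = form_value X \<sigma> x2 y u)"

definition chain :: "vname \<Rightarrow> state \<Rightarrow> nat \<Rightarrow> nat \<Rightarrow> nat \<Rightarrow> nat \<Rightarrow> nat" where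
  "chain X \<sigma> x1 x2 x3 i = rec_nat x3 (\<lambda>_ u. chain_step X \<sigma> x1 x2 u) (min i (\<sigma> ''n'' 0))"

text \<open>The coefficients are the digits of \<open>c\<close>. The code of the combination is
  found by comparing entries with every candidate, so that only the extraction of digits has to be
  programmed and not the encoding of vectors.\<close>

definition chain_comb :: "vname \<Rightarrow> state \<Rightarrow> nat \<Rightarrow> nat \<Rightarrow> nat \<Rightarrow> nat \<Rightarrow> nat" where
  "chain_comb X \<sigma> x1 x2 x3 c = search (codes \<sigma>) (\<lambda>x. \<forall>i<\<sigma> ''n'' 0.
     digit \<sigma> x i =
     field_sum \<sigma> (\<lambda>k. field_mult \<sigma> (digit \<sigma> c k) (digit \<sigma> (chain X \<sigma> x1 x2 x3 k) i)))"

text \<open>Independence is tested as injectivity of the map from coefficients to combinations,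
  which takes about q^(2n) comparisons and no elimination.\<close>

definition chain_indep :: "vname \<Rightarrow> state \<Rightarrow> nat \<Rightarrow> nat \<Rightarrow> nat \<Rightarrow> bool" where
  "chain_indep X \<sigma> x1 x2 x3 \<longleftrightarrow> (\<forall>c<codes \<sigma>. \<forall>d<codes \<sigma>.
     chain_comb X \<sigma> x1 x2 x3 c = chain_comb X \<sigma> x1 x2 x3 d \<longrightarrow> c = d)"

text \<open>Values are compared at all triples of combinations and not just at the basis vectors.
  This stays within the time bound and gives equality of the forms on the whole space without
  expanding along the bases.\<close>

definition accepts :: "state \<Rightarrow> bool" where
  "accepts \<sigma> \<longleftrightarrow>
     (\<exists>x1<codes \<sigma>. \<exists>x2<codes \<sigma>. \<exists>x3<codes \<sigma>. \<exists>y1<codes \<sigma>. \<exists>y2<codes \<sigma>. \<exists>y3<codes \<sigma>.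
        (chain_indep ''f'' \<sigma> x1 x2 x3 \<and> chain_indep ''g'' \<sigma> y1 y2 y3) \<and>
        (\<forall>c<codes \<sigma>. \<forall>d<codes \<sigma>. \<forall>e<codes \<sigma>.
           form_value ''f'' \<sigma> (chain_comb ''f'' \<sigma> x1 x2 x3 c) (chain_comb ''f'' \<sigma> x1 x2 x3 d)
             (chain_comb ''f'' \<sigma> x1 x2 x3 e) =
           form_value ''g'' \<sigma> (chain_comb ''g'' \<sigma> y1 y2 y3 c) (chain_comb ''g'' \<sigma> y1 y2 y3 d)
             (chain_comb ''g'' \<sigma> y1 y2 y3 e)))"

section \<open>Polynomial running time of every stage of the algorithm\<close>

lemma computable_codes: "computable D (\<lambda>\<sigma> _. codes \<sigma>)"
  by (intro computable_power computable_q computable_n poly_bounded_intros)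

lemma computable_field_add:
  "computable D a \<Longrightarrow> computable D b \<Longrightarrow> computable D (\<lambda>\<sigma> r. field_add \<sigma> (a \<sigma> r) (b \<sigma> r))"
  unfolding field_add_def
  by (intro computable_read computable_add computable_mult computable_q poly_bounded_intros) simp

lemma computable_field_mult:
  "computable D a \<Longrightarrow> computable D b \<Longrightarrow> computable D (\<lambda>\<sigma> r. field_mult \<sigma> (a \<sigma> r) (b \<sigma> r))"
  unfolding field_mult_def
  by (intro computable_read computable_add computable_mult computable_q poly_bounded_intros) simp

lemma computable_field_zero: "computable D (\<lambda>\<sigma> _. field_zero \<sigma>)"
  unfolding field_zero_def
  by (intro computable_search decidable_eq computable_field_add computable_q poly_bounded_intros)

lemma computable_field_sum:
  assumes "\<And>E \<kappa>. D \<le> E \<Longrightarrow> computable E \<kappa> \<Longrightarrow> computable E (\<lambda>\<sigma> r. h \<sigma> r (\<kappa> \<sigma> r))"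
  shows "computable D (\<lambda>\<sigma> r. field_sum \<sigma> (h \<sigma> r))"
  unfolding field_sum_def
  by (intro computable_fold computable_field_add computable_field_zero computable_n
      poly_bounded_intros assms)

lemma computable_digit:
  "computable D a \<Longrightarrow> computable D b \<Longrightarrow> computable D (\<lambda>\<sigma> r. digit \<sigma> (a \<sigma> r) (b \<sigma> r))"
  unfolding digit_def
  by (intro computable_mod computable_div computable_power computable_min computable_q
      computable_n computable_codes poly_bounded_intros)

lemma computable_form_value:
  assumes X: "X \<noteq> ''m''" and "computable D a" "computable D b" "computable D c"
  shows "computable D (\<lambda>\<sigma> r. form_value X \<sigma> (a \<sigma> r) (b \<sigma> r) (c \<sigma> r))"
  unfolding form_value_def using assms(2-4)
  \<comment> \<open>Every nested sum raises the register bound from \<open>D\<close> to some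
    \<open>E\<close>; \<open>computable_mono\<close> carries the arguments along, and they are
    recomputed in every round.\<close>
  by (intro computable_field_sum)
    (rule computable_field_mult computable_digit computable_read[OF X] computable_add
      computable_mult computable_n poly_bounded_intros | assumption
      | (rule computable_mono, assumption, linarith))+

lemma computable_chain_step:
  assumes X: "X \<noteq> ''m''" and "computable D a" "computable D b" "computable D c"
  shows "computable D (\<lambda>\<sigma> r. chain_step X \<sigma> (a \<sigma> r) (b \<sigma> r) (c \<sigma> r))"
  unfolding chain_step_def using assms(2-4)
  by (intro computable_search decidable_ball decidable_eq)
    (rule computable_form_value[OF X] computable_codes poly_bounded_intros | assumption
      | (rule computable_mono, assumption, linarith))+

lemma computable_chain:
  assumes X: "X \<noteq> ''m''"
    and "computable D a" "computable D b" "computable D c" "computable D i"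
  shows "computable D (\<lambda>\<sigma> r. chain X \<sigma> (a \<sigma> r) (b \<sigma> r) (c \<sigma> r) (i \<sigma> r))"
  unfolding chain_def using assms(2-)
  by (intro computable_fold)
    (rule computable_chain_step[OF X] computable_min computable_n poly_bounded_intros | assumption
      | (rule computable_mono, assumption, linarith))+

lemma computable_chain_comb:
  assumes X: "X \<noteq> ''m''"
    and "computable D a" "computable D b" "computable D c" "computable D i"
  shows "computable D (\<lambda>\<sigma> r. chain_comb X \<sigma> (a \<sigma> r) (b \<sigma> r) (c \<sigma> r) (i \<sigma> r))"
  unfolding chain_comb_def using assms(2-)
  by (intro computable_search decidable_ball decidable_eq computable_field_sum)
    (rule computable_field_mult computable_digit computable_chain[OF X] computable_codes
      computable_n poly_bounded_intros | assumption
      | (rule computable_mono, assumption, linarith))+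

lemma decidable_chain_indep:
  assumes X: "X \<noteq> ''m''" and "computable D a" "computable D b" "computable D c"
  shows "decidable D (\<lambda>\<sigma> r. chain_indep X \<sigma> (a \<sigma> r) (b \<sigma> r) (c \<sigma> r))"
  unfolding chain_indep_def using assms(2-)
  by (intro decidable_ball decidable_imp decidable_eq)
    (rule computable_chain_comb[OF X] computable_codes poly_bounded_intros | assumption
      | (rule computable_mono, assumption, linarith))+

lemma decidable_accepts: "decidable D (\<lambda>\<sigma> _. accepts \<sigma>)"
proof -
  have fg: "''f'' \<noteq> ''m''" "''g'' \<noteq> ''m''" by simp_all
  show ?thesis
    unfolding accepts_def
    by (intro decidable_bex decidable_ball decidable_conj)
      (rule decidable_chain_indep[OF fg(1)] decidable_chain_indep[OF fg(2)] decidable_eq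
        computable_form_value[OF fg(1)] computable_form_value[OF fg(2)]
        computable_chain_comb[OF fg(1)] computable_chain_comb[OF fg(2)]
        computable_codes poly_bounded_intros | assumption
        | (rule computable_mono, assumption, linarith))+
qed

lemma accepts_program:
  obtains alg K where "\<And>\<sigma>. \<exists>t s'. exec alg \<sigma> t s' \<and> t \<le> input_size \<sigma> ^ K \<and>
    s' ''out'' 0 = of_bool (accepts \<sigma>)"
proof -
  obtain c T where T: "poly_time T" and c: "computes 0 c (\<lambda>\<sigma> _. of_bool (accepts \<sigma>)) T"
    using computable_program[OF decidable_accepts[of 0, unfolded decidable_def] order.refl] by blast
  \<comment> \<open>Copying register 0 to \<open>out\<close> takes 1 + 2 + 1 time units.\<close>
  have "poly_time (\<lambda>\<sigma>. T \<sigma> + 4)" by (intro poly_time_intros T)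
  then obtain K where K: "\<And>\<sigma>. T \<sigma> + 4 \<le> input_size \<sigma> ^ K" unfolding poly_time_def by blast
  let ?alg = "Seq c (Store ''out'' (Num 0) (reg 0))"
  have "\<exists>t s'. exec ?alg \<sigma> t s' \<and> t \<le> input_size \<sigma> ^ K \<and> s' ''out'' 0 = of_bool (accepts \<sigma>)" for \<sigma>
  proof -
    \<comment> \<open>Taking the contents of \<open>m\<close> in the given state as initial
      registers makes the update the identity.\<close>
    obtain t r' where 1: "exec c (\<sigma>(''m'' := \<sigma> ''m'')) t (\<sigma>(''m'' := r'))" "t \<le> T \<sigma>"
      "r' 0 = of_bool (accepts \<sigma>)"
      using c unfolding computes_def by meson
    have e: "exec c \<sigma> t (\<sigma>(''m'' := r'))" using 1(1) by simp
    show ?thesis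
      by (intro exI conjI, rule exec.Seq[OF e exec.Store]) (use 1 K[of \<sigma>] in auto)
  qed
  then show ?thesis by (rule that)
qed

section \<open>Linear algebra over a record field\<close>

definition linear_map ::
  "('a, 'm) ring_scheme \<Rightarrow> nat \<Rightarrow> nat \<Rightarrow> ('a vec \<Rightarrow> 'a vec) \<Rightarrow> bool" where
  "linear_map F m n L \<longleftrightarrow>
     L \<in> vecs F m \<rightarrow> vecs F n \<and>
     (\<forall>u\<in>vecs F m. \<forall>v\<in>vecs F m. L (vec_add F m u v) = vec_add F n (L u) (L v)) \<and>
     (\<forall>c\<in>carrier F. \<forall>u\<in>vecs F m. L (vec_scale F m c u) = vec_scale F n c (L u))"

text \<open>The linear map from F^m to F^n with columns \<open>u j\<close>. Its injectivity serves
  as the definition of independence, and for \<open>m = n\<close> it says that \<open>u\<close> is a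
  basis.\<close>

definition lin_comb ::
  "('a, 'm) ring_scheme \<Rightarrow> nat \<Rightarrow> nat \<Rightarrow> (nat \<Rightarrow> 'a vec) \<Rightarrow> 'a vec \<Rightarrow> 'a vec" where
  "lin_comb F n m u c = (\<lambda>i\<in>{..<n}. \<Oplus>\<^bsub>F\<^esub>j\<in>{..<m}. c j \<otimes>\<^bsub>F\<^esub> u j i)"

lemma vecs_entry: "u \<in> vecs F n \<Longrightarrow> i < n \<Longrightarrow> u i \<in> carrier F"
  unfolding vecs_def by auto

lemma vecs_restrict: "(\<And>i. i < n \<Longrightarrow> u i \<in> carrier F) \<Longrightarrow> (\<lambda>i\<in>{..<n}. u i) \<in> vecs F n"
  unfolding vecs_def by auto

lemma vecs_eqI: "u \<in> vecs F n \<Longrightarrow> v \<in> vecs F n \<Longrightarrow> (\<And>i. i < n \<Longrightarrow> u i = v i) \<Longrightarrow> u = v"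
  unfolding vecs_def by (rule PiE_ext) auto

lemma finite_vecs: "finite (carrier F) \<Longrightarrow> finite (vecs F n)"
  unfolding vecs_def by (rule finite_PiE) auto

lemma card_vecs: "card (vecs F n) = card (carrier F) ^ n"
  unfolding vecs_def by (simp add: card_PiE)

lemma linear_map_closed: "linear_map F m n L \<Longrightarrow> u \<in> vecs F m \<Longrightarrow> L u \<in> vecs F n"
  unfolding linear_map_def by blast

lemma linear_map_add:
  "linear_map F m n L \<Longrightarrow> u \<in> vecs F m \<Longrightarrow> v \<in> vecs F m \<Longrightarrow>
    L (vec_add F m u v) = vec_add F n (L u) (L v)"
  unfolding linear_map_def by blast

lemma linear_map_scale:
  "linear_map F m n L \<Longrightarrow> c \<in> carrier F \<Longrightarrow> u \<in> vecs F m \<Longrightarrow>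
    L (vec_scale F m c u) = vec_scale F n c (L u)"
  unfolding linear_map_def by blast

lemma linear_map_compose:
  "linear_map F m n L \<Longrightarrow> linear_map F n k M \<Longrightarrow> linear_map F m k (\<lambda>u. M (L u))"
  unfolding linear_map_def by (auto simp: Pi_iff)

context field
begin

lemma vec_add_closed: "u \<in> vecs R n \<Longrightarrow> v \<in> vecs R n \<Longrightarrow> vec_add R n u v \<in> vecs R n"
  unfolding vec_add_def by (intro vecs_restrict a_closed) (auto dest: vecs_entry)

lemma vec_scale_closed: "c \<in> carrier R \<Longrightarrow> u \<in> vecs R n \<Longrightarrow> vec_scale R n c u \<in> vecs R n"
  unfolding vec_scale_def by (intro vecs_restrict m_closed) (auto dest: vecs_entry)

lemma std_basis_closed: "std_basis R n i \<in> vecs R n"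
  unfolding std_basis_def by (intro vecs_restrict) simp

lemma lin_comb_closed:
  "(\<And>j. j < m \<Longrightarrow> u j \<in> vecs R n) \<Longrightarrow> c \<in> vecs R m \<Longrightarrow> lin_comb R n m u c \<in> vecs R n"
  unfolding lin_comb_def
  by (intro vecs_restrict finsum_closed) (auto intro!: m_closed dest: vecs_entry)

lemma lin_comb_cong:
  assumes "\<And>j. j < m \<Longrightarrow> u j = v j" and v: "\<And>j. j < m \<Longrightarrow> v j \<in> vecs R n" and c: "c \<in> vecs R m"
  shows "lin_comb R n m u c = lin_comb R n m v c"
  unfolding lin_comb_def
  by (intro restrict_ext finsum_cong') (auto simp: assms(1) vecs_entry[OF v] vecs_entry[OF c])

lemma lin_comb_linear:
  assumes u: "\<And>j. j < m \<Longrightarrow> u j \<in> vecs R n"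
  shows "linear_map R m n (lin_comb R n m u)"
  unfolding linear_map_def
proof (intro conjI ballI)
  show "lin_comb R n m u \<in> vecs R m \<rightarrow> vecs R n" by (auto intro: lin_comb_closed u)
next
  fix c d assume c: "c \<in> vecs R m" and d: "d \<in> vecs R m"
  show "lin_comb R n m u (vec_add R m c d) = vec_add R n (lin_comb R n m u c) (lin_comb R n m u d)"
  proof (rule vecs_eqI[where F = R])
    fix i assume i: "i < n"
    have "(\<Oplus>j\<in>{..<m}. vec_add R m c d j \<otimes> u j i) = (\<Oplus>j\<in>{..<m}. (c j \<otimes> u j i) \<oplus> (d j \<otimes> u j i))"
      by (intro finsum_cong')
        (auto simp: vec_add_def l_distr vecs_entry[OF c] vecs_entry[OF d] vecs_entry[OF u] i)
    also have "\<dots> = (\<Oplus>j\<in>{..<m}. c j \<otimes> u j i) \<oplus> (\<Oplus>j\<in>{..<m}. d j \<otimes> u j i)"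
      by (intro finsum_addf) (auto intro!: m_closed simp: vecs_entry[OF c] vecs_entry[OF d] vecs_entry[OF u] i)
    finally show "lin_comb R n m u (vec_add R m c d) i =
        vec_add R n (lin_comb R n m u c) (lin_comb R n m u d) i"
      using i by (simp add: lin_comb_def vec_add_def[of R n])
  qed (intro vec_add_closed lin_comb_closed u c d; assumption)+
next
  fix a c assume a: "a \<in> carrier R" and c: "c \<in> vecs R m"
  show "lin_comb R n m u (vec_scale R m a c) = vec_scale R n a (lin_comb R n m u c)"
  proof (rule vecs_eqI[where F = R])
    fix i assume i: "i < n"
    have "(\<Oplus>j\<in>{..<m}. vec_scale R m a c j \<otimes> u j i) = (\<Oplus>j\<in>{..<m}. a \<otimes> (c j \<otimes> u j i))"
      by (intro finsum_cong')
        (auto simp: vec_scale_def m_assoc a vecs_entry[OF c] vecs_entry[OF u] i)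
    also have "\<dots> = a \<otimes> (\<Oplus>j\<in>{..<m}. c j \<otimes> u j i)"
      by (intro finsum_rdistr[symmetric])
        (auto intro!: m_closed simp: a vecs_entry[OF c] vecs_entry[OF u] i)
    finally show "lin_comb R n m u (vec_scale R m a c) i = vec_scale R n a (lin_comb R n m u c) i"
      using i by (simp add: lin_comb_def vec_scale_def[of R n])
  qed (intro vec_scale_closed lin_comb_closed u a c; assumption)+
qed

lemma lin_comb_std_basis:
  assumes u: "\<And>j. j < m \<Longrightarrow> u j \<in> vecs R n" and j: "j < m"
  shows "lin_comb R n m u (std_basis R m j) = u j"
proof (rule vecs_eqI[where F = R])
  fix i assume i: "i < n"
  have "(\<Oplus>k\<in>{..<m}. std_basis R m j k \<otimes> u k i) = (\<Oplus>k\<in>{..<m}. if j = k then u k i else \<zero>)"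
    by (intro finsum_cong') (auto simp: std_basis_def vecs_entry[OF u] i)
  also have "\<dots> = u j i"
    by (rule add.finprod_singleton) (auto simp: j vecs_entry[OF u] i)
  finally show "lin_comb R n m u (std_basis R m j) i = u j i" using i by (simp add: lin_comb_def)
qed (intro lin_comb_closed u std_basis_closed j; assumption)+

lemma linear_map_zero:
  assumes L: "linear_map R m n L"
  shows "L (\<lambda>i\<in>{..<m}. \<zero>) = (\<lambda>i\<in>{..<n}. \<zero>)"
proof -
  have z: "(\<lambda>i\<in>{..<m}. \<zero>) \<in> vecs R m" by (rule vecs_restrict) simp
  have "(\<lambda>i\<in>{..<m}. \<zero>) = vec_scale R m \<zero> (\<lambda>i\<in>{..<m}. \<zero>)"
    by (auto simp: vec_scale_def)
  then have "L (\<lambda>i\<in>{..<m}. \<zero>) = vec_scale R n \<zero> (L (\<lambda>i\<in>{..<m}. \<zero>))"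
    using linear_map_scale[OF L zero_closed z] by simp
  also have "\<dots> = (\<lambda>i\<in>{..<n}. \<zero>)"
    using vecs_entry[OF linear_map_closed[OF L z]] by (auto simp: vec_scale_def)
  finally show ?thesis .
qed

lemma linear_map_eq_lin_comb:
  assumes L: "linear_map R m n L" and c: "c \<in> vecs R m"
  shows "L c = lin_comb R n m (\<lambda>j. L (std_basis R m j)) c"
proof -
  let ?e = "std_basis R m"
  have Le: "L (?e j) \<in> vecs R n" for j by (intro linear_map_closed[OF L] std_basis_closed)
  \<comment> \<open>Induction over the truncations of \<open>c\<close> to its first \<open>t\<close>
    coordinates; the next coordinate enters as a multiple of a standard basis vector.\<close>
  have "L (\<lambda>i\<in>{..<m}. if i < t then c i else \<zero>) = (\<lambda>i\<in>{..<n}. \<Oplus>j\<in>{..<t}. c j \<otimes> L (?e j) i)"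
    if "t \<le> m" for t
    using that
  proof (induction t)
    case 0
    show ?case using linear_map_zero[OF L] by (simp only: not_less_zero if_False lessThan_0 finsum_empty)
  next
    case (Suc t)
    let ?c = "\<lambda>i\<in>{..<m}. if i < t then c i else \<zero>"
    have ct: "c t \<in> carrier R" using Suc.prems by (intro vecs_entry[OF c]) simp
    have cc: "?c \<in> vecs R m" by (rule vecs_restrict) (auto intro: vecs_entry[OF c])
    have "(\<lambda>i\<in>{..<m}. if i < Suc t then c i else \<zero>) = vec_add R m (vec_scale R m (c t) (?e t)) ?c"
      by (auto simp: vec_add_def vec_scale_def std_basis_def less_Suc_eq ct vecs_entry[OF c] fun_eq_iff)
    then have "L (\<lambda>i\<in>{..<m}. if i < Suc t then c i else \<zero>) =
        vec_add R n (vec_scale R n (c t) (L (?e t))) (L ?c)"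
      using linear_map_add[OF L vec_scale_closed[OF ct std_basis_closed] cc]
        linear_map_scale[OF L ct std_basis_closed] by simp
    also have "\<dots> = (\<lambda>i\<in>{..<n}. \<Oplus>j\<in>{..<Suc t}. c j \<otimes> L (?e j) i)"
    proof -
      have "(\<Oplus>j\<in>{..<Suc t}. c j \<otimes> L (?e j) i) =
          (c t \<otimes> L (?e t) i) \<oplus> (\<Oplus>j\<in>{..<t}. c j \<otimes> L (?e j) i)" if "i < n" for i
        unfolding lessThan_Suc using Suc.prems
        by (intro finsum_insert) (auto intro!: m_closed vecs_entry[OF c] vecs_entry[OF Le] that)
      moreover have "L ?c = (\<lambda>i\<in>{..<n}. \<Oplus>j\<in>{..<t}. c j \<otimes> L (?e j) i)"
        using Suc.prems by (intro Suc.IH) simp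
      ultimately show ?thesis
        unfolding vec_add_def vec_scale_def by (intro restrict_ext) (simp only: restrict_apply' lessThan_iff)
    qed
    finally show ?case .
  qed
  from this[of m] have "L (\<lambda>i\<in>{..<m}. if i < m then c i else \<zero>) =
      lin_comb R n m (\<lambda>j. L (?e j)) c"
    by (simp add: lin_comb_def)
  moreover have "(\<lambda>i\<in>{..<m}. if i < m then c i else \<zero>) = c"
    by (rule vecs_eqI[OF _ c]) (auto intro!: vecs_restrict vecs_entry[OF c])
  ultimately show ?thesis by simp
qed

lemma linear_map_lin_comb:
  assumes L: "linear_map R n k L" and u: "\<And>j. j < m \<Longrightarrow> u j \<in> vecs R n" and c: "c \<in> vecs R m"
  shows "L (lin_comb R n m u c) = lin_comb R k m (\<lambda>j. L (u j)) c"
proof -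
  have "L (lin_comb R n m u c) = lin_comb R k m (\<lambda>j. L (lin_comb R n m u (std_basis R m j))) c"
    using linear_map_eq_lin_comb[OF linear_map_compose[OF lin_comb_linear[OF u] L] c] by simp
  also have "\<dots> = lin_comb R k m (\<lambda>j. L (u j)) c"
    unfolding lin_comb_def[of R k]
    by (intro restrict_ext finsum_cong')
      (auto simp: lin_comb_std_basis[OF u] intro!: m_closed vecs_entry[OF c]
        vecs_entry[OF linear_map_closed[OF L]] u)
  finally show ?thesis .
qed

text \<open>A linear form is a linear map into the one-dimensional space, so the expansion of linear
  maps applies.\<close>

lemma linear_form_sum:
  assumes l: "linear_form R n l" and c: "c \<in> vecs R n"
  shows "l c = (\<Oplus>j\<in>{..<n}. c j \<otimes> l (std_basis R n j))"
proof -
  have "linear_map R n 1 (\<lambda>u. \<lambda>i\<in>{..<1}. l u)"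
    using l unfolding linear_form_def linear_map_def
    by (auto intro!: vecs_restrict simp: vec_add_def[of R "Suc 0"] vec_scale_def[of R "Suc 0"] Pi_iff)
  from linear_map_eq_lin_comb[OF this c] have "(\<lambda>i\<in>{..<1::nat}. l c) 0 =
      lin_comb R 1 n (\<lambda>j. \<lambda>i\<in>{..<1}. l (std_basis R n j)) c 0"
    by (rule fun_cong)
  then show ?thesis by (simp add: lin_comb_def)
qed

lemma linear_map_inv_into:
  assumes L: "linear_map R m n L" and bij: "bij_betw L (vecs R m) (vecs R n)"
  shows "linear_map R n m (inv_into (vecs R m) L)"
proof -
  let ?M = "inv_into (vecs R m) L"
  have M: "?M u \<in> vecs R m" "L (?M u) = u" if "u \<in> vecs R n" for u
    using bij that by (auto simp: bij_betw_def inv_into_into f_inv_into_f)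
  have inj: "?M (L u) = u" if "u \<in> vecs R m" for u
    using bij that by (auto simp: bij_betw_def)
  show ?thesis
    unfolding linear_map_def
  proof (intro conjI ballI)
    fix u v assume uv: "u \<in> vecs R n" "v \<in> vecs R n"
    show "?M (vec_add R n u v) = vec_add R m (?M u) (?M v)"
      using inj[OF vec_add_closed[OF M(1)[OF uv(1)] M(1)[OF uv(2)]]]
      by (simp add: linear_map_add[OF L] M uv)
  next
    fix c u assume cu: "c \<in> carrier R" "u \<in> vecs R n"
    show "?M (vec_scale R n c u) = vec_scale R m c (?M u)"
      using inj[OF vec_scale_closed[OF cu(1) M(1)[OF cu(2)]]]
      by (simp add: linear_map_scale[OF L] M cu)
  qed (use M in auto)
qed

section \<open>Square matrices and their correspondence with linear maps\<close>

lemma mat_entry: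
  "A \<in> carrier (mat_monoid R n) \<Longrightarrow> i < n \<Longrightarrow> j < n \<Longrightarrow> A (i, j) \<in> carrier R"
  by (auto simp: mat_monoid_def)

lemma mat_vec_eq_lin_comb:
  assumes A: "A \<in> carrier (mat_monoid R n)" and u: "u \<in> vecs R n"
  shows "mat_vec R n A u = lin_comb R n n (\<lambda>j. \<lambda>i\<in>{..<n}. A (i, j)) u"
  unfolding mat_vec_def lin_comb_def
  by (intro restrict_ext finsum_cong') (auto simp: mat_entry[OF A] intro!: m_comm vecs_entry[OF u])

lemma mat_column:
  "A \<in> carrier (mat_monoid R n) \<Longrightarrow> j < n \<Longrightarrow> (\<lambda>i\<in>{..<n}. A (i, j)) \<in> vecs R n"
  by (intro vecs_restrict) (auto simp: mat_monoid_def)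

lemma mat_vec_linear:
  assumes A: "A \<in> carrier (mat_monoid R n)"
  shows "linear_map R n n (mat_vec R n A)"
  using lin_comb_linear[of n "\<lambda>j. \<lambda>i\<in>{..<n}. A (i, j)" n, OF mat_column[OF A]]
  unfolding linear_map_def
  by (simp add: mat_vec_eq_lin_comb[OF A] vec_add_closed vec_scale_closed Pi_iff)

lemma mat_vec_std_basis:
  assumes A: "A \<in> carrier (mat_monoid R n)" and "j < n"
  shows "mat_vec R n A (std_basis R n j) = (\<lambda>i\<in>{..<n}. A (i, j))"
  using lin_comb_std_basis[of n "\<lambda>j. \<lambda>i\<in>{..<n}. A (i, j)" n, OF mat_column[OF A] assms(2)]
  by (simp add: mat_vec_eq_lin_comb[OF A std_basis_closed])

text \<open>The images of the standard basis vectors are the columns. The monoid laws for matrices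
  thereby follow from those for composition of maps.\<close>

lemma mat_eqI:
  assumes A: "A \<in> carrier (mat_monoid R n)" and B: "B \<in> carrier (mat_monoid R n)"
    and eq: "\<And>u. u \<in> vecs R n \<Longrightarrow> mat_vec R n A u = mat_vec R n B u"
  shows "A = B"
proof (rule PiE_ext)
  show "A \<in> {..<n} \<times> {..<n} \<rightarrow>\<^sub>E carrier R" "B \<in> {..<n} \<times> {..<n} \<rightarrow>\<^sub>E carrier R"
    using A B by (auto simp: mat_monoid_def)
  fix p assume "p \<in> {..<n} \<times> {..<n}"
  then obtain i j where p: "p = (i, j)" "i < n" "j < n" by auto
  have "(\<lambda>i\<in>{..<n}. A (i, j)) i = (\<lambda>i\<in>{..<n}. B (i, j)) i"
    using eq[OF std_basis_closed[of n j]] p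
    by (simp only: mat_vec_std_basis[OF A p(3)] mat_vec_std_basis[OF B p(3)])
  then show "A p = B p" using p by simp
qed

lemma mat_mult_closed:
  assumes A: "A \<in> carrier (mat_monoid R n)" and B: "B \<in> carrier (mat_monoid R n)"
  shows "A \<otimes>\<^bsub>mat_monoid R n\<^esub> B \<in> carrier (mat_monoid R n)"
  using A B by (auto simp: mat_monoid_def intro!: finsum_closed m_closed)

lemma mat_one_closed: "\<one>\<^bsub>mat_monoid R n\<^esub> \<in> carrier (mat_monoid R n)"
  by (auto simp: mat_monoid_def)

lemma mat_vec_mult:
  assumes A: "A \<in> carrier (mat_monoid R n)" and B: "B \<in> carrier (mat_monoid R n)"
    and u: "u \<in> vecs R n"
  shows "mat_vec R n (A \<otimes>\<^bsub>mat_monoid R n\<^esub> B) u = mat_vec R n A (mat_vec R n B u)"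
proof -
  have "mat_vec R n A (mat_vec R n B u) =
      lin_comb R n n (\<lambda>j. mat_vec R n A (\<lambda>i\<in>{..<n}. B (i, j))) u"
    unfolding mat_vec_eq_lin_comb[OF B u]
    by (rule linear_map_lin_comb[OF mat_vec_linear[OF A] mat_column[OF B] u])
  also have "\<dots> = lin_comb R n n (\<lambda>j. \<lambda>i\<in>{..<n}. (A \<otimes>\<^bsub>mat_monoid R n\<^esub> B) (i, j)) u"
  proof -
    have "mat_vec R n A (\<lambda>i\<in>{..<n}. B (i, j)) =
        (\<lambda>i\<in>{..<n}. (A \<otimes>\<^bsub>mat_monoid R n\<^esub> B) (i, j))" if "j < n" for j
      unfolding mat_vec_def
    proof (rule restrict_ext)
      fix i assume "i \<in> {..<n}"
      then have "(A \<otimes>\<^bsub>mat_monoid R n\<^esub> B) (i, j) = (\<Oplus>k\<in>{..<n}. A (i, k) \<otimes> B (k, j))"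
        using that by (simp add: mat_monoid_def)
      also have "\<dots> = (\<Oplus>k\<in>{..<n}. A (i, k) \<otimes> (\<lambda>i\<in>{..<n}. B (i, j)) k)"
        using that \<open>i \<in> {..<n}\<close> by (intro finsum_cong') (auto simp: mat_entry[OF A] mat_entry[OF B])
      finally show "(\<Oplus>k\<in>{..<n}. A (i, k) \<otimes> (\<lambda>i\<in>{..<n}. B (i, j)) k) =
        (A \<otimes>\<^bsub>mat_monoid R n\<^esub> B) (i, j)" by (rule sym)
    qed
    then show ?thesis
      unfolding lin_comb_def
      by (intro restrict_ext finsum_cong')
        (auto intro!: m_closed vecs_entry[OF u] vecs_entry[OF mat_column[OF mat_mult_closed[OF A B]]]
          simp del: restrict_apply)
  qed
  finally show ?thesis by (simp add: mat_vec_eq_lin_comb[OF mat_mult_closed[OF A B] u])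
qed

lemma mat_vec_one:
  assumes u: "u \<in> vecs R n"
  shows "mat_vec R n \<one>\<^bsub>mat_monoid R n\<^esub> u = u"
proof (rule vecs_eqI[OF _ u])
  show "mat_vec R n \<one>\<^bsub>mat_monoid R n\<^esub> u \<in> vecs R n"
    by (rule linear_map_closed[OF mat_vec_linear[OF mat_one_closed] u])
  fix i assume i: "i < n"
  have "(\<Oplus>j\<in>{..<n}. \<one>\<^bsub>mat_monoid R n\<^esub> (i, j) \<otimes> u j) = (\<Oplus>j\<in>{..<n}. if i = j then u j else \<zero>)"
    by (intro finsum_cong') (auto simp: mat_monoid_def i vecs_entry[OF u])
  also have "\<dots> = u i" by (rule add.finprod_singleton) (auto simp: i vecs_entry[OF u])
  finally show "mat_vec R n \<one>\<^bsub>mat_monoid R n\<^esub> u i = u i" using i by (simp add: mat_vec_def)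
qed

lemma mat_monoid: "monoid (mat_monoid R n)"
proof (rule monoidI)
  fix A B C assume "A \<in> carrier (mat_monoid R n)" "B \<in> carrier (mat_monoid R n)"
    "C \<in> carrier (mat_monoid R n)"
  then show "A \<otimes>\<^bsub>mat_monoid R n\<^esub> B \<otimes>\<^bsub>mat_monoid R n\<^esub> C =
      A \<otimes>\<^bsub>mat_monoid R n\<^esub> (B \<otimes>\<^bsub>mat_monoid R n\<^esub> C)"
    by (intro mat_eqI[where n = n])
      (simp_all add: mat_mult_closed mat_vec_mult linear_map_closed[OF mat_vec_linear])
next
  fix A assume A: "A \<in> carrier (mat_monoid R n)"
  show "\<one>\<^bsub>mat_monoid R n\<^esub> \<otimes>\<^bsub>mat_monoid R n\<^esub> A = A" "A \<otimes>\<^bsub>mat_monoid R n\<^esub> \<one>\<^bsub>mat_monoid R n\<^esub> = A"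
    by (intro mat_eqI[where n = n], simp_all add: A mat_mult_closed mat_one_closed mat_vec_mult mat_vec_one
        linear_map_closed[OF mat_vec_linear[OF A]])+
qed (auto intro: mat_mult_closed mat_one_closed)

lemma linear_map_matrix:
  assumes L: "linear_map R n n L"
  obtains A where "A \<in> carrier (mat_monoid R n)"
    "\<And>u. u \<in> vecs R n \<Longrightarrow> mat_vec R n A u = L u"
proof
  let ?A = "\<lambda>(i, j)\<in>{..<n} \<times> {..<n}. L (std_basis R n j) i"
  have e: "L (std_basis R n j) \<in> vecs R n" for j by (rule linear_map_closed[OF L std_basis_closed])
  show A: "?A \<in> carrier (mat_monoid R n)"
    by (auto simp: mat_monoid_def intro: vecs_entry[OF e])
  show "mat_vec R n ?A u = L u" if u: "u \<in> vecs R n" for u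
    unfolding mat_vec_eq_lin_comb[OF A u] linear_map_eq_lin_comb[OF L u] lin_comb_def
    by (intro restrict_ext finsum_cong') (auto intro!: m_closed vecs_entry[OF e] vecs_entry[OF u])
qed

text \<open>Here \<open>L\<close> is the action of the inverse of the group element. Conversely the
  inverse of a bijective linear map is linear, so both have matrices, and these are inverse to each
  other. Correctness of the algorithm can then be argued with maps alone.\<close>

lemma equivalent_forms_iff:
  "equivalent_forms R n f g \<longleftrightarrow>
     (\<exists>L. linear_map R n n L \<and> bij_betw L (vecs R n) (vecs R n) \<and>
        (\<forall>u\<in>vecs R n. \<forall>v\<in>vecs R n. \<forall>w\<in>vecs R n. f u v w = g (L u) (L v) (L w)))"
proof
  interpret M: monoid "mat_monoid R n" by (rule mat_monoid)
  assume "equivalent_forms R n f g"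
  then obtain A where A: "A \<in> Units (mat_monoid R n)"
    and eq: "\<forall>u\<in>vecs R n. \<forall>v\<in>vecs R n. \<forall>w\<in>vecs R n. f u v w = form_act R n g A u v w"
    unfolding equivalent_forms_def GL_def units_of_def by auto
  let ?B = "inv\<^bsub>mat_monoid R n\<^esub> A"
  have c: "A \<in> carrier (mat_monoid R n)" "?B \<in> carrier (mat_monoid R n)" using A by auto
  note cl = linear_map_closed[OF mat_vec_linear]
  have "mat_vec R n A (mat_vec R n ?B u) = u" "mat_vec R n ?B (mat_vec R n A u) = u"
    if "u \<in> vecs R n" for u
    using that A c by (simp_all add: mat_vec_mult[symmetric] mat_vec_one)
  then have "bij_betw (mat_vec R n ?B) (vecs R n) (vecs R n)"
    by (intro bij_betw_byWitness[where f' = "mat_vec R n A"]) (auto intro: cl c)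
  then show "\<exists>L. linear_map R n n L \<and> bij_betw L (vecs R n) (vecs R n) \<and>
        (\<forall>u\<in>vecs R n. \<forall>v\<in>vecs R n. \<forall>w\<in>vecs R n. f u v w = g (L u) (L v) (L w))"
    using eq mat_vec_linear[OF c(2)] A
    by (intro exI[of _ "mat_vec R n ?B"]) (simp add: form_act_def GL_def M.units_of_inv Let_def)
next
  interpret M: monoid "mat_monoid R n" by (rule mat_monoid)
  assume "\<exists>L. linear_map R n n L \<and> bij_betw L (vecs R n) (vecs R n) \<and>
        (\<forall>u\<in>vecs R n. \<forall>v\<in>vecs R n. \<forall>w\<in>vecs R n. f u v w = g (L u) (L v) (L w))"
  then obtain L where L: "linear_map R n n L" and bij: "bij_betw L (vecs R n) (vecs R n)"
    and eq: "\<forall>u\<in>vecs R n. \<forall>v\<in>vecs R n. \<forall>w\<in>vecs R n. f u v w = g (L u) (L v) (L w)"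
    by blast
  let ?K = "inv_into (vecs R n) L"
  have K: "?K u \<in> vecs R n" "L (?K u) = u" "?K (L u) = u" if "u \<in> vecs R n" for u
    using bij that by (auto simp: bij_betw_def inv_into_into f_inv_into_f)
  obtain B where B: "B \<in> carrier (mat_monoid R n)" "\<And>u. u \<in> vecs R n \<Longrightarrow> mat_vec R n B u = L u"
    using linear_map_matrix[OF L] by blast
  obtain A where A: "A \<in> carrier (mat_monoid R n)" "\<And>u. u \<in> vecs R n \<Longrightarrow> mat_vec R n A u = ?K u"
    using linear_map_matrix[OF linear_map_inv_into[OF L bij]] by blast
  have AB: "A \<otimes>\<^bsub>mat_monoid R n\<^esub> B = \<one>\<^bsub>mat_monoid R n\<^esub>"
    by (intro mat_eqI[where n = n]) (simp_all add: mat_vec_mult mat_vec_one A B K linear_map_closed[OF L])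
  have BA: "B \<otimes>\<^bsub>mat_monoid R n\<^esub> A = \<one>\<^bsub>mat_monoid R n\<^esub>"
    by (intro mat_eqI[where n = n]) (simp_all add: mat_vec_mult mat_vec_one A B K)
  have U: "A \<in> Units (mat_monoid R n)" unfolding Units_def using A(1) B(1) AB BA by blast
  have inv: "inv\<^bsub>mat_monoid R n\<^esub> A = B" by (rule M.inv_char[OF A(1) B(1) AB BA])
  show "equivalent_forms R n f g"
    unfolding equivalent_forms_def
    by (intro bexI[of _ A])
      (use eq U in \<open>auto simp: form_act_def GL_def M.units_of_inv Let_def inv B(2) units_of_carrier\<close>)
qed

end

section \<open>Correctness of the algorithm\<close>

lemma base_digits_inj:
  "(\<And>i. i < n \<Longrightarrow> x div q ^ i mod q = y div q ^ i mod q) \<Longrightarrow> x < q ^ n \<Longrightarrow> y < q ^ n \<Longrightarrow> x = y"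
  for q x y :: nat
proof (induction n arbitrary: x y)
  case (Suc n)
  have "x div q = y div q"
  proof (rule Suc.IH)
    show "x div q div q ^ i mod q = y div q div q ^ i mod q" if "i < n" for i
      using Suc.prems(1)[of "Suc i"] that by (simp add: div_mult2_eq)
    show "x div q < q ^ n" "y div q < q ^ n"
      using Suc.prems(2,3) by (auto intro: less_mult_imp_div_less simp: mult.commute)
  qed
  moreover have "x mod q = y mod q" using Suc.prems(1)[of 0] by simp
  ultimately show ?case by (metis div_mod_decomp)
qed simp

lemma (in field) trilinear_closed:
  "trilinear R n h \<Longrightarrow> u \<in> vecs R n \<Longrightarrow> v \<in> vecs R n \<Longrightarrow> w \<in> vecs R n \<Longrightarrow> h u v w \<in> carrier R"
  unfolding trilinear_def linear_form_def by blast

text \<open>The machine sees only the array of a form; this identity turns its nested sums into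
  values of the form itself.\<close>

lemma (in field) trilinear_eq_form_of_array:
  assumes h: "trilinear R n h" and u: "u \<in> vecs R n" and v: "v \<in> vecs R n" and w: "w \<in> vecs R n"
  shows "h u v w = form_of_array R n (array_of_form R n h) u v w"
proof -
  let ?e = "std_basis R n"
  note e = std_basis_closed
  note cl = vecs_entry[OF u] vecs_entry[OF v] vecs_entry[OF w] trilinear_closed[OF h] e u v w
  have 1: "h a b w = (\<Oplus>k\<in>{..<n}. w k \<otimes> h a b (?e k))" if "a \<in> vecs R n" "b \<in> vecs R n" for a b
    using h that w linear_form_sum[of n "\<lambda>x. h a b x" w] unfolding trilinear_def by blast
  have 2: "h a v w = (\<Oplus>j\<in>{..<n}. v j \<otimes> h a (?e j) w)" if "a \<in> vecs R n" for a
    using h that v w linear_form_sum[of n "\<lambda>x. h a x w" v] unfolding trilinear_def by blast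
  have 3: "h u v w = (\<Oplus>i\<in>{..<n}. u i \<otimes> h (?e i) v w)"
    using h u v w linear_form_sum[of n "\<lambda>x. h x v w" u] unfolding trilinear_def by blast
  have s2: "v j \<otimes> h (?e i) (?e j) w = (\<Oplus>k\<in>{..<n}. v j \<otimes> (w k \<otimes> h (?e i) (?e j) (?e k)))"
    if "j < n" for i j
    unfolding 1[OF e e] using that
    by (intro finsum_rdistr) (auto simp: cl)
  have s3: "u i \<otimes> h (?e i) v w =
      (\<Oplus>j\<in>{..<n}. \<Oplus>k\<in>{..<n}. h (?e i) (?e j) (?e k) \<otimes> u i \<otimes> v j \<otimes> w k)" if i: "i < n" for i
  proof -
    have "u i \<otimes> h (?e i) v w = (\<Oplus>j\<in>{..<n}. u i \<otimes> (v j \<otimes> h (?e i) (?e j) w))"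
      unfolding 2[OF e] using i by (intro finsum_rdistr) (auto simp: cl)
    also have "\<dots> = (\<Oplus>j\<in>{..<n}. \<Oplus>k\<in>{..<n}. h (?e i) (?e j) (?e k) \<otimes> u i \<otimes> v j \<otimes> w k)"
    proof (rule finsum_cong'[OF refl])
      show "(\<lambda>j. \<Oplus>k\<in>{..<n}. h (?e i) (?e j) (?e k) \<otimes> u i \<otimes> v j \<otimes> w k) \<in> {..<n} \<rightarrow> carrier R"
        using i by (auto simp: cl intro!: finsum_closed m_closed)
      fix j assume "j \<in> {..<n}"
      then have j: "j < n" by simp
      have "u i \<otimes> (v j \<otimes> h (?e i) (?e j) w) =
          (\<Oplus>k\<in>{..<n}. u i \<otimes> (v j \<otimes> (w k \<otimes> h (?e i) (?e j) (?e k))))"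
        unfolding s2[OF j] using i j by (intro finsum_rdistr) (auto simp: cl)
      also have "\<dots> = (\<Oplus>k\<in>{..<n}. h (?e i) (?e j) (?e k) \<otimes> u i \<otimes> v j \<otimes> w k)"
        by (rule finsum_cong'[OF refl]) (use i j in \<open>auto simp: cl m_ac\<close>)
      finally show "u i \<otimes> (v j \<otimes> h (?e i) (?e j) w) =
          (\<Oplus>k\<in>{..<n}. h (?e i) (?e j) (?e k) \<otimes> u i \<otimes> v j \<otimes> w k)" .
    qed
    finally show ?thesis .
  qed
  show ?thesis
    unfolding 3 form_of_array_def array_of_form_def prod.case
    by (rule finsum_cong'[OF refl]) (auto simp: s3 cl intro!: finsum_closed m_closed)
qed

text \<open>The first clause is nondegeneracy of \<open>h a\<close> and makes each successor unique.
  That successors exist is part of the last clause and is not derived from the first. The starting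
  vector \<open>u 0\<close> is left free.\<close>

definition good_chain :: "('a, 'm) ring_scheme \<Rightarrow> nat \<Rightarrow> 'a form \<Rightarrow> 'a vec \<Rightarrow> 'a vec \<Rightarrow>
    (nat \<Rightarrow> 'a vec) \<Rightarrow> bool" where
  "good_chain F n h a b u \<longleftrightarrow>
     (\<forall>w\<in>vecs F n. \<forall>w'\<in>vecs F n. (\<forall>y\<in>vecs F n. h a y w = h a y w') \<longrightarrow> w = w') \<and>
     (\<forall>i<n. u i \<in> vecs F n) \<and>
     (\<forall>i. Suc i < n \<longrightarrow> (\<forall>y\<in>vecs F n. h a y (u (Suc i)) = h b y (u i)))"

text \<open>A condition on one form alone: the exceptional set must be the same for every second
  form.\<close>

definition good_form :: "('a, 'm) ring_scheme \<Rightarrow> nat \<Rightarrow> 'a form \<Rightarrow> bool" where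
  "good_form F n h \<longleftrightarrow> (\<exists>a\<in>vecs F n. \<exists>b\<in>vecs F n. \<exists>u.
     good_chain F n h a b u \<and> inj_on (lin_comb F n n u) (vecs F n))"

section \<open>Meaning of the machine's computations on a well-formed input\<close>

lemma table_entry: "x < q \<Longrightarrow> y < q \<Longrightarrow> table q h (x * q + y) = h x y"
proof -
  assume xy: "x < q" "y < q"
  have "x * q + y < Suc x * q" using xy by simp
  also have "\<dots> \<le> q * q" using xy by (intro mult_right_mono) auto
  finally show ?thesis using xy by (simp add: table_def)
qed

lemma flat_array_entry:
  assumes "i < n" "j < n" "k < n"
  shows "flat_array n a ((i * n + j) * n + k) = a (i, j, k)"
proof -
  let ?m = "(i * n + j) * n + k"
  have ij: "i * n + j < n * n"
  proof -
    have "i * n + j < Suc i * n" using assms by simp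
    also have "\<dots> \<le> n * n" using assms by (intro mult_right_mono) auto
    finally show ?thesis .
  qed
  have "?m < Suc (i * n + j) * n" using assms by simp
  also have "\<dots> \<le> n * n * n" using ij by (intro mult_right_mono) auto
  finally have "?m < n * n * n" .
  moreover have d: "?m div n = i * n + j" using assms by simp
  moreover have "?m div (n * n) = i" unfolding div_mult2_eq d using assms by simp
  ultimately show ?thesis using assms by (simp add: flat_array_def)
qed

text \<open>Only sizes and tables of the state are fixed here, so the two forms of a pair share one
  decoding of vectors.\<close>

locale coded_field = field F for F :: "nat ring" (structure) +
  fixes q n :: nat and \<sigma> :: state
  assumes carrier_eq: "carrier F = {..<q}"
    and sq: "\<sigma> ''q'' 0 = q" and sn: "\<sigma> ''n'' 0 = n"
    and sadd: "\<sigma> ''add'' = table q (add F)" and smul: "\<sigma> ''mul'' = table q (monoid.mult F)"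
begin

lemma q_pos: "0 < q"
  using zero_closed carrier_eq by auto

lemma field_add_eq: "x \<in> carrier F \<Longrightarrow> y \<in> carrier F \<Longrightarrow> field_add \<sigma> x y = x \<oplus> y"
  by (simp add: field_add_def sadd sq table_entry carrier_eq)

lemma field_mult_eq: "x \<in> carrier F \<Longrightarrow> y \<in> carrier F \<Longrightarrow> field_mult \<sigma> x y = x \<otimes> y"
  by (simp add: field_mult_def smul sq table_entry carrier_eq)

text \<open>In the additive group, \<open>\<zero>\<close> is the only solution of
  \<open>z \<oplus> z = z\<close>, so the search has a unique witness.\<close>

lemma field_zero_eq: "field_zero \<sigma> = \<zero>"
  unfolding field_zero_def sq
proof (rule search_unique)
  show "\<zero> < q" using zero_closed carrier_eq by auto
  show "field_add \<sigma> \<zero> \<zero> = \<zero>" by (simp add: field_add_eq)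
  fix z assume "z < q" "field_add \<sigma> z z = z"
  then have "z \<in> carrier F" "z \<oplus> z = z" by (auto simp: field_add_eq carrier_eq)
  then show "z = \<zero>" by (metis add.r_cancel_one')
qed

lemma field_sum_eq:
  assumes "\<And>i. i < n \<Longrightarrow> h i = k i" "\<And>i. i < n \<Longrightarrow> k i \<in> carrier F"
  shows "field_sum \<sigma> h = (\<Oplus>i\<in>{..<n}. k i)"
proof -
  have "rec_nat (field_zero \<sigma>) (\<lambda>i a. field_add \<sigma> a (h i)) m = (\<Oplus>i\<in>{..<m}. k i)" if "m \<le> n" for m
    using that
  proof (induction m)
    case 0
    then show ?case by (simp add: field_zero_eq)
  next
    case (Suc m)
    have s: "(\<Oplus>i\<in>{..<m}. k i) \<in> carrier F" using Suc.prems assms(2) by (intro finsum_closed) auto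
    have "(\<Oplus>i\<in>{..<Suc m}. k i) = k m \<oplus> (\<Oplus>i\<in>{..<m}. k i)"
      unfolding lessThan_Suc using Suc.prems assms(2) by (intro finsum_insert) auto
    also have "\<dots> = (\<Oplus>i\<in>{..<m}. k i) \<oplus> k m" using s Suc.prems assms(2) by (intro a_comm) auto
    finally show ?case using Suc s assms by (simp add: field_add_eq)
  qed
  then show ?thesis unfolding field_sum_def sn by simp
qed

definition decode :: "nat \<Rightarrow> nat vec" where
  "decode x = (\<lambda>i\<in>{..<n}. digit \<sigma> x i)"

lemma digit_carrier: "digit \<sigma> x i \<in> carrier F"
  using q_pos by (simp add: digit_def carrier_eq sq)

lemma decode_closed: "decode x \<in> vecs F n"
  unfolding decode_def by (intro vecs_restrict digit_carrier)

lemma decode_entry: "i < n \<Longrightarrow> decode x i = digit \<sigma> x i"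
  by (simp add: decode_def)

text \<open>Base \<open>q\<close> digits determine a number below \<open>q ^ n\<close>; surjectivity
  then follows by comparing cardinalities.\<close>

lemma decode_bij: "bij_betw decode {..<q ^ n} (vecs F n)"
proof -
  have inj: "inj_on decode {..<q ^ n}"
  proof (rule inj_onI)
    fix x y assume xy: "x \<in> {..<q ^ n}" "y \<in> {..<q ^ n}" "decode x = decode y"
    have "x div q ^ i mod q = y div q ^ i mod q" if i: "i < n" for i
      using fun_cong[OF xy(3), of i] xy(1,2) i
      by (simp add: decode_entry digit_def sq sn min_def)
    then show "x = y" using xy(1,2) by (auto intro: base_digits_inj)
  qed
  moreover have "decode ` {..<q ^ n} = vecs F n"
  proof (rule card_subset_eq)
    show "finite (vecs F n)" by (rule finite_vecs) (simp add: carrier_eq)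
    show "card (decode ` {..<q ^ n}) = card (vecs F n)"
      by (simp add: card_image[OF inj] card_vecs carrier_eq)
  qed (auto intro: decode_closed)
  ultimately show ?thesis unfolding bij_betw_def by blast
qed

lemma decode_surj: "u \<in> vecs F n \<Longrightarrow> \<exists>x<q ^ n. decode x = u"
  using decode_bij unfolding bij_betw_def by (metis imageE lessThan_iff)

lemma decode_inj: "x < q ^ n \<Longrightarrow> y < q ^ n \<Longrightarrow> decode x = decode y \<longleftrightarrow> x = y"
  using decode_bij unfolding bij_betw_def inj_on_def by auto

lemma all_codes: "(\<forall>x<q ^ n. P (decode x)) \<longleftrightarrow> (\<forall>u\<in>vecs F n. P u)"
  using decode_surj decode_closed by metis

lemma codes_eq: "codes \<sigma> = q ^ n"
  by (simp add: sq sn)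

end

locale coded_form = coded_field F q n \<sigma> for F :: "nat ring" (structure) and q n \<sigma> +
  fixes X :: vname and h :: "nat form"
  assumes h: "trilinear F n h" and sX: "\<sigma> X = flat_array n (array_of_form F n h)"
begin

lemma form_value_eq: "form_value X \<sigma> x y z = h (decode x) (decode y) (decode z)"
proof -
  let ?a = "array_of_form F n h"
  have a: "?a (i, j, k) \<in> carrier F" for i j k
    by (simp add: array_of_form_def trilinear_closed[OF h] std_basis_closed)
  have "form_value X \<sigma> x y z = form_of_array F n ?a (decode x) (decode y) (decode z)"
    unfolding form_value_def form_of_array_def
    by (intro field_sum_eq finsum_closed)
      (auto simp: decode_entry sX sn flat_array_entry field_mult_eq a digit_carrier
        intro!: finsum_closed m_closed)
  then show ?thesis
    by (simp add: trilinear_eq_form_of_array[OF h decode_closed decode_closed decode_closed])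
qed

text \<open>Nondegeneracy supplies the uniqueness that the search requires, and \<open>u\<close>
  supplies existence.\<close>

lemma chain_step_eq:
  assumes nondeg: "\<forall>w\<in>vecs F n. \<forall>w'\<in>vecs F n.
      (\<forall>y\<in>vecs F n. h (decode x1) y w = h (decode x1) y w') \<longrightarrow> w = w'"
    and u: "u \<in> vecs F n" "\<And>y. y \<in> vecs F n \<Longrightarrow> h (decode x1) y u = h (decode x2) y (decode x)"
  shows "decode (chain_step X \<sigma> x1 x2 x) = u"
proof -
  obtain w where w: "w < q ^ n" "decode w = u" using decode_surj[OF u(1)] by blast
  have "chain_step X \<sigma> x1 x2 x = w"
    unfolding chain_step_def codes_eq
  proof (rule search_unique[OF w(1)])
    show "\<forall>y<q ^ n. form_value X \<sigma> x1 y w = form_value X \<sigma> x2 y x"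
      unfolding form_value_eq w(2) using u(2) decode_closed by blast
    fix v assume v: "v < q ^ n" "\<forall>y<q ^ n. form_value X \<sigma> x1 y v = form_value X \<sigma> x2 y x"
    then have "\<forall>y\<in>vecs F n. h (decode x1) y (decode v) = h (decode x2) y (decode x)"
      unfolding form_value_eq
      using all_codes[of "\<lambda>y. h (decode x1) y (decode v) = h (decode x2) y (decode x)"] by blast
    then have "decode v = decode w"
      using nondeg u(2) decode_closed[of v] u(1) unfolding w(2) by metis
    then show "v = w" using v(1) w(1) decode_inj by blast
  qed
  then show ?thesis using w by simp
qed

lemma chain_eq:
  assumes good: "good_chain F n h (decode x1) (decode x2) u" and x3: "decode x3 = u 0"
    and "i < n"
  shows "decode (chain X \<sigma> x1 x2 x3 i) = u i"
  using assms(3)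
proof (induction i)
  case 0
  then show ?case by (simp add: chain_def x3)
next
  case (Suc i)
  have "chain X \<sigma> x1 x2 x3 (Suc i) = chain_step X \<sigma> x1 x2 (chain X \<sigma> x1 x2 x3 i)"
    using Suc.prems by (simp add: chain_def sn min_def)
  also have "decode \<dots> = u (Suc i)"
    using good Suc unfolding good_chain_def by (intro chain_step_eq) auto
  finally show ?case .
qed

abbreviation chain_map :: "nat \<Rightarrow> nat \<Rightarrow> nat \<Rightarrow> nat vec \<Rightarrow> nat vec" where
  "chain_map x1 x2 x3 \<equiv> lin_comb F n n (\<lambda>k. decode (chain X \<sigma> x1 x2 x3 k))"

lemma chain_map_linear: "linear_map F n n (chain_map x1 x2 x3)"
  by (intro lin_comb_linear decode_closed)

text \<open>Unlike a chain step, this search always succeeds, so the description holds for every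
  choice of \<open>x1\<close>, \<open>x2\<close>, \<open>x3\<close>. Soundness depends on
  that.\<close>

lemma chain_comb_eq:
  "chain_comb X \<sigma> x1 x2 x3 c < q ^ n"
  "decode (chain_comb X \<sigma> x1 x2 x3 c) = chain_map x1 x2 x3 (decode c)"
proof -
  let ?v = "chain_map x1 x2 x3 (decode c)"
  have v: "?v \<in> vecs F n" by (intro lin_comb_closed decode_closed)
  obtain w where w: "w < q ^ n" "decode w = ?v" using decode_surj[OF v] by blast
  have iff: "(\<forall>i<n. digit \<sigma> x i =
      field_sum \<sigma> (\<lambda>k. field_mult \<sigma> (digit \<sigma> c k) (digit \<sigma> (chain X \<sigma> x1 x2 x3 k) i))) \<longleftrightarrow>
      decode x = ?v" for x
  proof -
    have eq: "field_sum \<sigma> (\<lambda>k. field_mult \<sigma> (digit \<sigma> c k) (digit \<sigma> (chain X \<sigma> x1 x2 x3 k) i)) = ?v i"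
      if "i < n" for i
      using that unfolding lin_comb_def
      by (simp, intro field_sum_eq) (auto simp: field_mult_eq digit_carrier decode_entry)
    show ?thesis (is "?L \<longleftrightarrow> ?R")
    proof
      assume ?L
      then show ?R by (intro vecs_eqI[OF decode_closed v]) (simp only: decode_entry eq)
    next
      assume R: ?R
      show ?L
      proof (intro allI impI)
        fix i assume i: "i < n"
        show "digit \<sigma> x i = field_sum \<sigma>
            (\<lambda>k. field_mult \<sigma> (digit \<sigma> c k) (digit \<sigma> (chain X \<sigma> x1 x2 x3 k) i))"
          using decode_entry[OF i, of x] eq[OF i] unfolding R by (rule trans[OF sym sym])
      qed
    qed
  qed
  have "chain_comb X \<sigma> x1 x2 x3 c = w"
    unfolding chain_comb_def sq sn iff
  proof (rule search_unique[OF w(1)])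
    show "decode w = ?v" by (rule w(2))
    fix y assume "y < q ^ n" "decode y = ?v"
    then show "y = w" using decode_inj[OF _ w(1), of y] w(2) by simp
  qed
  then show "chain_comb X \<sigma> x1 x2 x3 c < q ^ n"
    "decode (chain_comb X \<sigma> x1 x2 x3 c) = ?v" using w by auto
qed

lemma chain_indep_iff:
  "chain_indep X \<sigma> x1 x2 x3 \<longleftrightarrow> inj_on (chain_map x1 x2 x3) (vecs F n)"
proof -
  let ?m = "chain_map x1 x2 x3"
  have "chain_comb X \<sigma> x1 x2 x3 c = chain_comb X \<sigma> x1 x2 x3 d \<longleftrightarrow> ?m (decode c) = ?m (decode d)"
    for c d
    using decode_inj[OF chain_comb_eq(1) chain_comb_eq(1)] chain_comb_eq(2) by metis
  then have "chain_indep X \<sigma> x1 x2 x3 \<longleftrightarrow>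
      (\<forall>c<q ^ n. \<forall>d<q ^ n. ?m (decode c) = ?m (decode d) \<longrightarrow> decode c = decode d)"
    unfolding chain_indep_def codes_eq using decode_inj by metis
  also have "\<dots> \<longleftrightarrow> (\<forall>c\<in>vecs F n. \<forall>d\<in>vecs F n. ?m c = ?m d \<longrightarrow> c = d)"
    using decode_surj decode_closed by metis
  finally show ?thesis unfolding inj_on_def .
qed

end

section \<open>Soundness for all forms and completeness for good ones\<close>

locale coded_pair =
  f: coded_form F q n \<sigma> "''f''" f + g: coded_form F q n \<sigma> "''g''" g
  for F :: "nat ring" (structure) and q n \<sigma> f g
begin

lemma accepts_iff:
  "accepts \<sigma> \<longleftrightarrow> (\<exists>x1<q ^ n. \<exists>x2<q ^ n. \<exists>x3<q ^ n. \<exists>y1<q ^ n. \<exists>y2<q ^ n. \<exists>y3<q ^ n.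
     (inj_on (f.chain_map x1 x2 x3) (vecs F n) \<and> inj_on (g.chain_map y1 y2 y3) (vecs F n)) \<and>
     (\<forall>c\<in>vecs F n. \<forall>d\<in>vecs F n. \<forall>e\<in>vecs F n.
        f (f.chain_map x1 x2 x3 c) (f.chain_map x1 x2 x3 d) (f.chain_map x1 x2 x3 e) =
        g (g.chain_map y1 y2 y3 c) (g.chain_map y1 y2 y3 d) (g.chain_map y1 y2 y3 e)))"
proof -
  have *: "(\<forall>c<q ^ n. \<forall>d<q ^ n. \<forall>e<q ^ n. P (f.decode c) (f.decode d) (f.decode e)) \<longleftrightarrow>
      (\<forall>c\<in>vecs F n. \<forall>d\<in>vecs F n. \<forall>e\<in>vecs F n. P c d e)" for P
    using f.decode_surj f.decode_closed by metis
  show ?thesis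
    unfolding accepts_def f.codes_eq f.chain_indep_iff g.chain_indep_iff
      f.form_value_eq g.form_value_eq f.chain_comb_eq(2) g.chain_comb_eq(2) *[symmetric] ..
qed

text \<open>The equivalence sends each combination of the vectors found for \<open>f\<close> to the
  combination with the same coefficients of those found for \<open>g\<close>: it is
  \<open>?N\<close> after the inverse of \<open>?M\<close>. Injective linear maps of a finite space
  are bijective.\<close>

lemma accepts_sound:
  assumes "accepts \<sigma>"
  shows "equivalent_forms F n f g"
proof -
  obtain x1 x2 x3 y1 y2 y3 where
    inj: "inj_on (f.chain_map x1 x2 x3) (vecs F n)" "inj_on (g.chain_map y1 y2 y3) (vecs F n)" and
    eq: "\<forall>c\<in>vecs F n. \<forall>d\<in>vecs F n. \<forall>e\<in>vecs F n.
        f (f.chain_map x1 x2 x3 c) (f.chain_map x1 x2 x3 d) (f.chain_map x1 x2 x3 e) =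
        g (g.chain_map y1 y2 y3 c) (g.chain_map y1 y2 y3 d) (g.chain_map y1 y2 y3 e)"
    using assms unfolding accepts_iff by blast
  let ?V = "vecs F n" and ?M = "f.chain_map x1 x2 x3" and ?N = "g.chain_map y1 y2 y3"
  have fin: "finite ?V" by (rule finite_vecs) (simp add: f.carrier_eq)
  have bij: "bij_betw L ?V ?V" if "linear_map F n n L" "inj_on L ?V" for L
    unfolding bij_betw_def using that linear_map_closed[OF that(1)]
    by (auto intro!: endo_inj_surj[OF fin])
  note M = bij[OF f.chain_map_linear inj(1)] and N = bij[OF g.chain_map_linear inj(2)]
  let ?K = "inv_into ?V ?M"
  have K: "?K u \<in> ?V" "?M (?K u) = u" if "u \<in> ?V" for u
    using M that by (auto simp: bij_betw_def inv_into_into f_inv_into_f)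
  have "linear_map F n n (\<lambda>u. ?N (?K u))"
    by (rule linear_map_compose[OF f.linear_map_inv_into[OF f.chain_map_linear M] g.chain_map_linear])
  moreover have "bij_betw (\<lambda>u. ?N (?K u)) ?V ?V"
    using bij_betw_trans[OF bij_betw_inv_into[OF M] N] by (simp add: comp_def)
  moreover have "\<forall>u\<in>?V. \<forall>v\<in>?V. \<forall>w\<in>?V. f u v w = g (?N (?K u)) (?N (?K v)) (?N (?K w))"
    using eq K by metis
  ultimately show ?thesis
    unfolding f.equivalent_forms_iff by (intro exI[of _ "\<lambda>u. ?N (?K u)"]) simp
qed

text \<open>\<open>L\<close> carries a good chain of \<open>f\<close> to a good chain of
  \<open>g\<close> that starts from the images of \<open>a\<close>, \<open>b\<close> and
  \<open>u 0\<close>. With their codes as witnesses, the chain map computed for \<open>g\<close> is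
  \<open>L\<close> after the one computed for \<open>f\<close>, and the values agree. Goodness is
  assumed of \<open>f\<close> because \<open>L\<close> transports it to \<open>g\<close>.\<close>

lemma accepts_complete:
  assumes "equivalent_forms F n f g" and good: "good_form F n f"
  shows "accepts \<sigma>"
proof -
  let ?V = "vecs F n"
  obtain L where L: "linear_map F n n L" "bij_betw L ?V ?V"
    and eq: "\<And>u v w. u \<in> ?V \<Longrightarrow> v \<in> ?V \<Longrightarrow> w \<in> ?V \<Longrightarrow> f u v w = g (L u) (L v) (L w)"
    using assms(1) unfolding f.equivalent_forms_iff by blast
  obtain a b u where ab: "a \<in> ?V" "b \<in> ?V" and gc: "good_chain F n f a b u"
    and inj: "inj_on (lin_comb F n n u) ?V"
    using good unfolding good_form_def by blast
  note Lc = linear_map_closed[OF L(1)]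
  have surj: "\<exists>u\<in>?V. L u = v" if "v \<in> ?V" for v
    using L(2) that unfolding bij_betw_def by (metis imageE)
  have Linj: "L u = L v \<longleftrightarrow> u = v" if "u \<in> ?V" "v \<in> ?V" for u v
    using L(2) that unfolding bij_betw_def inj_on_def by blast
  have u: "u i \<in> ?V" if "i < n" for i using gc that unfolding good_chain_def by blast
  have gc': "good_chain F n g (L a) (L b) (\<lambda>i. L (u i))"
    unfolding good_chain_def
  proof (intro conjI ballI allI impI)
    fix w w' assume w: "w \<in> ?V" "w' \<in> ?V" and e: "\<forall>y\<in>?V. g (L a) y w = g (L a) y w'"
    obtain v v' where v: "v \<in> ?V" "L v = w" "v' \<in> ?V" "L v' = w'" using surj w by metis
    have "f a y v = f a y v'" if "y \<in> ?V" for y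
      using e Lc[OF that] eq[OF ab(1) that v(1)] eq[OF ab(1) that v(3)] v by simp
    then have "v = v'" using gc v unfolding good_chain_def by blast
    then show "w = w'" using v by simp
  next
    fix i y assume i: "Suc i < n" and "y \<in> ?V"
    then obtain z where z: "z \<in> ?V" "L z = y" using surj by blast
    have "f a z (u (Suc i)) = f b z (u i)" using gc i z unfolding good_chain_def by blast
    then show "g (L a) y (L (u (Suc i))) = g (L b) y (L (u i))"
      using eq[OF ab(1) z(1) u[OF i]] eq[OF ab(2) z(1) u[OF Suc_lessD[OF i]]] z by simp
  qed (use u Lc in auto)
  obtain x1 where x1: "x1 < q ^ n" "f.decode x1 = a" using f.decode_surj[OF ab(1)] by blast
  obtain x2 where x2: "x2 < q ^ n" "f.decode x2 = b" using f.decode_surj[OF ab(2)] by blast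
  obtain y1 where y1: "y1 < q ^ n" "f.decode y1 = L a" using f.decode_surj[OF Lc[OF ab(1)]] by blast
  obtain y2 where y2: "y2 < q ^ n" "f.decode y2 = L b" using f.decode_surj[OF Lc[OF ab(2)]] by blast
  \<comment> \<open>For \<open>n = 0\<close> the chain is empty and \<open>u 0\<close> is
    unconstrained, so any code serves.\<close>
  have "\<exists>x3<q ^ n. 0 < n \<longrightarrow> f.decode x3 = u 0"
    using f.decode_surj[OF u[of 0]] f.q_pos by (cases "n = 0") auto
  then obtain x3 where x3: "x3 < q ^ n" "0 < n \<Longrightarrow> f.decode x3 = u 0" by blast
  have "\<exists>y3<q ^ n. 0 < n \<longrightarrow> f.decode y3 = L (u 0)"
    using f.decode_surj[OF Lc[OF u[of 0]]] f.q_pos by (cases "n = 0") auto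
  then obtain y3 where y3: "y3 < q ^ n" "0 < n \<Longrightarrow> f.decode y3 = L (u 0)" by blast
  have cf: "f.decode (chain ''f'' \<sigma> x1 x2 x3 k) = u k" if "k < n" for k
    using f.chain_eq[of x1 x2 u x3 k] gc x1 x2 x3 that by auto
  have cg: "f.decode (chain ''g'' \<sigma> y1 y2 y3 k) = L (u k)" if "k < n" for k
    using g.chain_eq[of y1 y2 "\<lambda>i. L (u i)" y3 k] gc' y1 y2 y3 that by auto
  have mf: "f.chain_map x1 x2 x3 c = lin_comb F n n u c" if "c \<in> ?V" for c
    by (rule f.lin_comb_cong[OF cf u that])
  have mg: "g.chain_map y1 y2 y3 c = L (lin_comb F n n u c)" if "c \<in> ?V" for c
  proof -
    have "L (lin_comb F n n u c) = lin_comb F n n (\<lambda>j. L (u j)) c"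
      by (rule f.linear_map_lin_comb[OF L(1) _ that]) (rule u)
    also have "\<dots> = g.chain_map y1 y2 y3 c"
      by (rule f.lin_comb_cong[symmetric, OF _ _ that]) (auto simp: cg intro: Lc u)
    finally show ?thesis by (rule sym)
  qed
  have lc: "lin_comb F n n u c \<in> ?V" if "c \<in> ?V" for c by (rule f.lin_comb_closed[OF u that])
  show ?thesis
    unfolding accepts_iff
  proof (intro exI conjI ballI)
    show "inj_on (f.chain_map x1 x2 x3) ?V" using inj by (simp add: inj_on_def mf)
    show "inj_on (g.chain_map y1 y2 y3) ?V" using inj by (simp add: inj_on_def mg Linj lc)
  qed (use x1 x2 x3 y1 y2 y3 in \<open>auto simp: mf mg eq lc\<close>)
qed

end

lemma coded_pair_input_state:
  assumes "field F" "carrier F = {..<q}" "trilinear F n f" "trilinear F n g"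
  shows "coded_pair F q n (input_state F n f g) f g"
proof -
  interpret field F by (rule assms)
  show ?thesis
    by unfold_locales (simp_all add: assms input_state_def)
qed

section \<open>Counting pairs of matrices\<close>

locale finite_field = field R for R (structure) +
  assumes finite_carrier: "finite (carrier R)"
begin

abbreviation q :: nat where "q \<equiv> card (carrier R)"

lemma q_ge_2: "2 \<le> q"
proof -
  have "card {\<zero>, \<one>} \<le> q" using finite_carrier by (intro card_mono) auto
  then show ?thesis by simp
qed

text \<open>Independent sequences of length \<open>k\<close> whose first member lies in
  \<open>W\<close>. With \<open>W\<close> the whole space and \<open>k = n\<close> they are the
  columns of invertible matrices; with \<open>W\<close> consisting of the first standard basis
  vector they are the possible chains.\<close>

definition indep_seqs :: "nat \<Rightarrow> 'a vec set \<Rightarrow> nat \<Rightarrow> (nat \<Rightarrow> 'a vec) set" where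
  "indep_seqs n W k = {u \<in> {..<k} \<rightarrow>\<^sub>E vecs R n. inj_on (lin_comb R n k u) (vecs R k) \<and> (0 < k \<longrightarrow> u 0 \<in> W)}"

lemma lin_comb_Suc:
  assumes u: "\<And>j. j < k \<Longrightarrow> u j \<in> vecs R n" and w: "w \<in> vecs R n" and c: "c \<in> vecs R (Suc k)"
    and i: "i < n"
  shows "lin_comb R n (Suc k) (u(k := w)) c i =
    (c k \<otimes> w i) \<oplus> lin_comb R n k u (restrict c {..<k}) i"
proof -
  have "(\<Oplus>j\<in>{..<Suc k}. c j \<otimes> (u(k := w)) j i) =
      (c k \<otimes> (u(k := w)) k i) \<oplus> (\<Oplus>j\<in>{..<k}. c j \<otimes> (u(k := w)) j i)"
    unfolding lessThan_Suc
    by (intro finsum_insert) (auto simp: i vecs_entry[OF c] vecs_entry[OF u] vecs_entry[OF w])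
  also have "(\<Oplus>j\<in>{..<k}. c j \<otimes> (u(k := w)) j i) = (\<Oplus>j\<in>{..<k}. restrict c {..<k} j \<otimes> u j i)"
    by (intro finsum_cong') (auto simp: i vecs_entry[OF c] vecs_entry[OF u])
  finally show ?thesis using i by (simp add: lin_comb_def)
qed

lemma minus_nonzero: "s \<in> carrier R \<Longrightarrow> t \<in> carrier R \<Longrightarrow> s \<noteq> t \<Longrightarrow> s \<ominus> t \<noteq> \<zero>"
  by (metis a_minus_def add.inv_closed add.inv_inv add.inv_equality)

text \<open>The difference is written with the factor \<open>\<ominus> \<one>\<close> so that the
  right-hand side is an entry built from \<open>vec_add\<close> and
  \<open>vec_scale\<close>.\<close>

lemma solve_for:
  assumes "s \<in> carrier R" "t \<in> carrier R" "s \<noteq> t" "w \<in> carrier R" "x \<in> carrier R" "y \<in> carrier R"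
    and eq: "(s \<otimes> w) \<oplus> x = (t \<otimes> w) \<oplus> y"
  shows "w = inv (s \<ominus> t) \<otimes> (y \<oplus> (\<ominus> \<one>) \<otimes> x)"
proof -
  have U: "s \<ominus> t \<in> Units R" using assms(1,2) by (simp add: field_Units minus_nonzero[OF assms(1-3)])
  have "(s \<ominus> t) \<otimes> w = ((s \<otimes> w) \<oplus> x) \<ominus> (t \<otimes> w) \<ominus> x"
    using assms(1,2,4,5,6) by algebra
  also have "\<dots> = y \<oplus> (\<ominus> \<one>) \<otimes> x"
    unfolding eq using assms(1,2,4,5,6) by algebra
  finally have "inv (s \<ominus> t) \<otimes> ((s \<ominus> t) \<otimes> w) = inv (s \<ominus> t) \<otimes> (y \<oplus> (\<ominus> \<one>) \<otimes> x)" by simp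
  then show ?thesis using U assms(1,2,4) by (simp add: m_assoc[symmetric])
qed

text \<open>If two equal combinations had different last coefficients, \<open>w\<close> could be
  solved for and would lie in the span of \<open>u\<close>; equal last coefficients cancel. The set
  \<open>W\<close> matters only when \<open>w\<close> becomes the first member.\<close>

lemma indep_seqs_extend:
  assumes u: "u \<in> indep_seqs n W k" and w: "w \<in> vecs R n - lin_comb R n k u ` vecs R k"
    and W: "0 < k \<or> w \<in> W"
  shows "u(k := w) \<in> indep_seqs n W (Suc k)"
proof -
  have uP: "u \<in> {..<k} \<rightarrow>\<^sub>E vecs R n" and inj: "inj_on (lin_comb R n k u) (vecs R k)"
    using u unfolding indep_seqs_def by auto
  have uV: "u j \<in> vecs R n" if "j < k" for j using uP that by auto
  have wV: "w \<in> vecs R n" using w by blast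
  have lin: "linear_map R k n (lin_comb R n k u)" by (rule lin_comb_linear) (rule uV)
  have lc: "lin_comb R n (Suc k) (u(k := w)) c i =
      (c k \<otimes> w i) \<oplus> lin_comb R n k u (restrict c {..<k}) i"
    if "c \<in> vecs R (Suc k)" "i < n" for c i
    by (rule lin_comb_Suc[OF _ wV that]) (rule uV)
  have "inj_on (lin_comb R n (Suc k) (u(k := w))) (vecs R (Suc k))"
  proof (rule inj_onI)
    fix c d assume c: "c \<in> vecs R (Suc k)" and d: "d \<in> vecs R (Suc k)"
      and eq: "lin_comb R n (Suc k) (u(k := w)) c = lin_comb R n (Suc k) (u(k := w)) d"
    let ?c = "restrict c {..<k}" and ?d = "restrict d {..<k}"
    have cd: "?c \<in> vecs R k" "?d \<in> vecs R k"
      using vecs_entry[OF c] vecs_entry[OF d] by (auto intro!: vecs_restrict)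
    let ?x = "lin_comb R n k u ?c" and ?y = "lin_comb R n k u ?d"
    have xy: "?x \<in> vecs R n" "?y \<in> vecs R n" using cd by (auto intro: lin_comb_closed uV)
    have ck: "c k \<in> carrier R" "d k \<in> carrier R" using vecs_entry[OF c] vecs_entry[OF d] by auto
    have e: "(c k \<otimes> w i) \<oplus> ?x i = (d k \<otimes> w i) \<oplus> ?y i" if "i < n" for i
      using fun_cong[OF eq, of i] lc[OF c that] lc[OF d that] by simp
    have same: "c k = d k"
    proof (rule ccontr)
      assume ne: "c k \<noteq> d k"
      let ?r = "inv (c k \<ominus> d k)"
      have r: "?r \<in> carrier R"
        using ne ck by (intro Units_inv_closed) (simp add: field_Units minus_nonzero)
      let ?e = "vec_add R k ?d (vec_scale R k (\<ominus> \<one>) ?c)"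
      have eV: "vec_scale R k (\<ominus> \<one>) ?c \<in> vecs R k" "?e \<in> vecs R k"
        using cd by (auto intro!: vec_add_closed vec_scale_closed)
      have "lin_comb R n k u (vec_scale R k ?r ?e) =
          vec_scale R n ?r (vec_add R n ?y (vec_scale R n (\<ominus> \<one>) ?x))"
        using linear_map_scale[OF lin r eV(2)] linear_map_add[OF lin cd(2) eV(1)]
          linear_map_scale[OF lin add.inv_closed[OF one_closed] cd(1)] by simp
      also have "\<dots> = w"
      proof (rule vecs_eqI[OF _ wV])
        show "vec_scale R n ?r (vec_add R n ?y (vec_scale R n (\<ominus> \<one>) ?x)) \<in> vecs R n"
          using r xy by (auto intro!: vec_add_closed vec_scale_closed)
        fix i assume i: "i < n"
        have "w i = ?r \<otimes> (?y i \<oplus> (\<ominus> \<one>) \<otimes> ?x i)"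
          using ne ck vecs_entry[OF xy(1) i] vecs_entry[OF xy(2) i] vecs_entry[OF wV i] e[OF i]
          by (intro solve_for) auto
        then show "vec_scale R n ?r (vec_add R n ?y (vec_scale R n (\<ominus> \<one>) ?x)) i = w i"
          using i by (simp add: vec_scale_def vec_add_def)
      qed
      finally have "w \<in> lin_comb R n k u ` vecs R k"
        using vec_scale_closed[OF r eV(2)] by (metis imageI)
      then show False using w by blast
    qed
    have "?x = ?y"
    proof (rule vecs_eqI[OF xy])
      fix i assume i: "i < n"
      show "?x i = ?y i"
        using e[OF i] ck vecs_entry[OF wV i] vecs_entry[OF xy(1) i] vecs_entry[OF xy(2) i] same
        by simp
    qed
    then have "?c = ?d" using inj cd by (auto dest: inj_onD)
    then have "c i = d i" if "i < k" for i using that by (metis lessThan_iff restrict_apply')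
    then show "c = d" using same by (intro vecs_eqI[OF c d]) (auto simp: less_Suc_eq)
  qed
  moreover have "u(k := w) \<in> {..<Suc k} \<rightarrow>\<^sub>E vecs R n"
    using uP wV by (auto simp: PiE_iff extensional_def)
  moreover have "(u(k := w)) 0 \<in> W" using W u by (auto simp: indep_seqs_def)
  ultimately show ?thesis unfolding indep_seqs_def by blast
qed

lemma finite_indep_seqs: "finite (indep_seqs n W k)"
  unfolding indep_seqs_def
  by (rule finite_subset[OF _ finite_PiE[of "{..<k}" "\<lambda>_. vecs R n"]])
    (auto intro: finite_vecs finite_carrier)

lemma indep_seqs_eqI:
  assumes "u \<in> indep_seqs n W k" "v \<in> indep_seqs n W k" "\<And>j. j < k \<Longrightarrow> u j = v j"
  shows "u = v"
proof (rule PiE_ext)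
  show "u \<in> {..<k} \<rightarrow>\<^sub>E vecs R n" "v \<in> {..<k} \<rightarrow>\<^sub>E vecs R n"
    using assms(1,2) by (auto simp: indep_seqs_def)
qed (use assms(3) in auto)

lemma indep_seqs_0: "(\<lambda>_. undefined) \<in> indep_seqs n W 0"
  unfolding indep_seqs_def by (auto simp: inj_on_def vecs_def)

text \<open>The span of \<open>k\<close> independent vectors has exactly \<open>q ^ k\<close>
  elements, and each vector outside it gives an extension. Sequences are undefined at
  \<open>k\<close>, so writing there loses nothing and the extension map is injective.\<close>

lemma card_indep_seqs_Suc:
  assumes "0 < k"
  shows "card (indep_seqs n W k) * (q ^ n - q ^ k) \<le> card (indep_seqs n W (Suc k))"
proof -
  let ?D = "SIGMA u:indep_seqs n W k. vecs R n - lin_comb R n k u ` vecs R k"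
  let ?g = "\<lambda>(u, w). u(k := w) :: nat \<Rightarrow> 'a vec"
  have fin: "finite (vecs R n)" "finite (vecs R k)" by (auto intro: finite_vecs finite_carrier)
  have card1: "card (vecs R n - lin_comb R n k u ` vecs R k) = q ^ n - q ^ k"
    if "u \<in> indep_seqs n W k" for u
  proof -
    have "lin_comb R n k u ` vecs R k \<subseteq> vecs R n" "inj_on (lin_comb R n k u) (vecs R k)"
      using that by (auto simp: indep_seqs_def intro!: lin_comb_closed)
    then show ?thesis using fin by (simp add: card_Diff_subset card_image card_vecs)
  qed
  have "card ?D = card (indep_seqs n W k) * (q ^ n - q ^ k)"
    using fin by (subst card_SigmaI) (auto simp: finite_indep_seqs card1)
  moreover have "card ?D \<le> card (indep_seqs n W (Suc k))"
  proof (rule card_inj_on_le)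
    show "inj_on ?g ?D"
    proof (rule inj_onI, clarify)
      fix u w v z assume uv: "u \<in> indep_seqs n W k" "v \<in> indep_seqs n W k" and eq: "u(k := w) = v(k := z)"
      have "u i = v i" for i
      proof (cases "i = k")
        case True
        then show ?thesis using uv by (auto simp: indep_seqs_def PiE_iff extensional_def)
      next
        case False
        then show ?thesis using fun_cong[OF eq, of i] by simp
      qed
      moreover have "w = z" using fun_cong[OF eq, of k] by simp
      ultimately show "u = v \<and> w = z" by auto
    qed
    show "?g ` ?D \<subseteq> indep_seqs n W (Suc k)" using assms by (auto intro!: indep_seqs_extend)
  qed (rule finite_indep_seqs)
  ultimately show ?thesis by simp
qed

text \<open>Factor \<open>j\<close> counts the extensions of \<open>j\<close> independent vectors.
  The first vector has a factor of its own, since it ranges over \<open>W\<close> and avoids only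
  zero, the span of the empty sequence.\<close>

lemma card_indep_seqs:
  assumes W: "W \<subseteq> vecs R n"
  shows "card (W - {\<lambda>i\<in>{..<n}. \<zero>}) * (\<Prod>j\<in>{1..<Suc k}. q ^ n - q ^ j) \<le> card (indep_seqs n W (Suc k))"
proof (induction k)
  case 0
  let ?z = "\<lambda>i\<in>{..<n}. \<zero>"
  let ?g = "\<lambda>w. (\<lambda>_. undefined)(0 := w) :: nat \<Rightarrow> 'a vec"
  have "lin_comb R n 0 (\<lambda>_. undefined) ` vecs R 0 \<subseteq> {?z}"
    by (auto simp: lin_comb_def)
  then have "?g ` (W - {?z}) \<subseteq> indep_seqs n W (Suc 0)"
    using W by (intro image_subsetI indep_seqs_extend indep_seqs_0) auto
  moreover have "inj_on ?g (W - {?z})" by (rule inj_onI) (metis fun_upd_same)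
  ultimately have "card (W - {?z}) \<le> card (indep_seqs n W (Suc 0))"
    by (intro card_inj_on_le finite_indep_seqs)
  then show ?case by (simp del: restrict_apply)
next
  case (Suc k)
  have "card (W - {\<lambda>i\<in>{..<n}. \<zero>}) * (\<Prod>j\<in>{1..<Suc (Suc k)}. q ^ n - q ^ j) =
     (card (W - {\<lambda>i\<in>{..<n}. \<zero>}) * (\<Prod>j\<in>{1..<Suc k}. q ^ n - q ^ j)) * (q ^ n - q ^ Suc k)"
    by (simp add: mult.assoc del: restrict_apply)
  also have "\<dots> \<le> card (indep_seqs n W (Suc k)) * (q ^ n - q ^ Suc k)"
    by (rule mult_right_mono[OF Suc]) simp
  also have "\<dots> \<le> card (indep_seqs n W (Suc (Suc k)))" by (rule card_indep_seqs_Suc) simp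
  finally show ?case .
qed

section \<open>Invertible matrices and pairs with a cyclic vector\<close>

abbreviation mats :: "nat \<Rightarrow> 'a sqmat set" where
  "mats n \<equiv> carrier (mat_monoid R n)"

lemma finite_mats: "finite (mats n)"
  unfolding mat_monoid_def by (simp add: finite_PiE finite_carrier)

lemma card_mats: "card (mats n) = (q ^ n) ^ n"
  unfolding mat_monoid_def by (simp add: card_PiE power_mult)

definition nonsingular :: "nat \<Rightarrow> 'a sqmat set" where
  "nonsingular n = {A \<in> mats n. inj_on (mat_vec R n A) (vecs R n)}"

lemma card_nonsingular: "card (indep_seqs n (vecs R n) n) \<le> card (nonsingular n)"
proof (rule card_inj_on_le)
  let ?g = "\<lambda>u. \<lambda>(i, j)\<in>{..<n} \<times> {..<n}. u j i :: 'a"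
  have col: "(\<lambda>i\<in>{..<n}. ?g u (i, j)) = u j" if "u \<in> indep_seqs n (vecs R n) n" "j < n" for u j
  proof -
    have "u j \<in> vecs R n" using that by (auto simp: indep_seqs_def)
    then show ?thesis
      using that(2) by (intro vecs_eqI[of _ R n]) (auto intro!: vecs_restrict dest: vecs_entry)
  qed
  have mat: "?g u \<in> mats n" if "u \<in> indep_seqs n (vecs R n) n" for u
  proof -
    have "u j i \<in> carrier R" if "i < n" "j < n" for i j
      using \<open>u \<in> _\<close> that by (intro vecs_entry[of "u j" R n]) (auto simp: indep_seqs_def)
    then show ?thesis by (auto simp: mat_monoid_def)
  qed
  show "inj_on ?g (indep_seqs n (vecs R n) n)"
  proof (rule inj_onI)
    fix u v assume uv: "u \<in> indep_seqs n (vecs R n) n" "v \<in> indep_seqs n (vecs R n) n" "?g u = ?g v"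
    have "u j = v j" if "j < n" for j using col[OF uv(1) that] col[OF uv(2) that] uv(3) by simp
    then show "u = v" by (rule indep_seqs_eqI[OF uv(1,2)])
  qed
  show "?g ` indep_seqs n (vecs R n) n \<subseteq> nonsingular n"
  proof (rule image_subsetI)
    fix u assume u: "u \<in> indep_seqs n (vecs R n) n"
    have "mat_vec R n (?g u) c = lin_comb R n n u c" if "c \<in> vecs R n" for c
      unfolding mat_vec_eq_lin_comb[OF mat[OF u] that]
      by (rule lin_comb_cong[OF col[OF u] _ that]) (use u in \<open>auto simp: indep_seqs_def\<close>)
    then show "?g u \<in> nonsingular n"
      using mat[OF u] u by (simp add: nonsingular_def indep_seqs_def inj_on_def)
  qed
  show "finite (nonsingular n)" using finite_mats by (simp add: nonsingular_def)
qed

text \<open>Cyclicity for the quotient of the two matrices is stated without an inverse, as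
  \<open>A\<close> applied to the next vector equals \<open>B\<close> applied to the current one.
  This is the chain equation of a form whose slices are \<open>A\<close> and
  \<open>B\<close>.\<close>

definition good_pairs :: "nat \<Rightarrow> ('a sqmat \<times> 'a sqmat) set" where
  "good_pairs n = {(A, B). A \<in> nonsingular n \<and> B \<in> mats n \<and>
     (\<exists>u\<in>indep_seqs n {std_basis R n 0} n.
        \<forall>i. Suc i < n \<longrightarrow> mat_vec R n A (u (Suc i)) = mat_vec R n B (u i))}"

text \<open>A linear map is freely prescribed on a basis. Requiring that it sends each basis vector to
  \<open>A\<close> times the next one leaves only the image of the last basis vector open.\<close>

lemma card_good_pairs:
  assumes n: "0 < n"
  shows "card (nonsingular n) * (card (indep_seqs n {std_basis R n 0} n) * q ^ n) \<le> card (good_pairs n)"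
proof -
  let ?V = "vecs R n" and ?U = "indep_seqs n {std_basis R n 0} n"
  let ?P = "\<lambda>A u z B. B \<in> mats n \<and>
    (\<forall>i<n. mat_vec R n B (u i) = (if Suc i < n then mat_vec R n A (u (Suc i)) else z))"
  define g where "g = (\<lambda>(A, u, z). (A :: 'a sqmat, SOME B. ?P A u z B))"
  have ex: "?P A u z (snd (g (A, u, z)))" if A: "A \<in> nonsingular n" and u: "u \<in> ?U" and z: "z \<in> ?V" for A u z
  proof -
    let ?t = "\<lambda>i. if Suc i < n then mat_vec R n A (u (Suc i)) else z"
    have uV: "u i \<in> ?V" if "i < n" for i using u that by (auto simp: indep_seqs_def)
    have inj: "inj_on (lin_comb R n n u) ?V" using u by (auto simp: indep_seqs_def)
    have AM: "A \<in> mats n" using A by (simp add: nonsingular_def)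
    have tV: "?t i \<in> ?V" if "i < n" for i
      using z uV linear_map_closed[OF mat_vec_linear[OF AM]] by auto
    have fin: "finite ?V" by (intro finite_vecs finite_carrier)
    have bij: "bij_betw (lin_comb R n n u) ?V ?V"
      unfolding bij_betw_def using inj lin_comb_closed[OF uV]
      by (auto intro!: endo_inj_surj[OF fin])
    have lin: "linear_map R n n (\<lambda>v. lin_comb R n n ?t (inv_into ?V (lin_comb R n n u) v))"
      by (intro linear_map_compose[OF linear_map_inv_into[OF lin_comb_linear bij] lin_comb_linear] uV tV)
    obtain B where B: "B \<in> mats n"
      "\<And>v. v \<in> ?V \<Longrightarrow> mat_vec R n B v = lin_comb R n n ?t (inv_into ?V (lin_comb R n n u) v)"
      using linear_map_matrix[OF lin] by blast
    have "mat_vec R n B (u i) = ?t i" if i: "i < n" for i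
    proof -
      have "inv_into ?V (lin_comb R n n u) (u i) = std_basis R n i"
        using inv_into_f_f[OF inj std_basis_closed, of i] lin_comb_std_basis[of n u n i] uV i by simp
      then show ?thesis unfolding B(2)[OF uV[OF i]] using lin_comb_std_basis[of n ?t n i] tV i by simp
    qed
    then have "?P A u z B" using B(1) by blast
    then show ?thesis unfolding g_def prod.case snd_conv by (rule someI[where P = "?P A u z"])
  qed
  have "card (nonsingular n \<times> ?U \<times> ?V) \<le> card (good_pairs n)"
  proof (rule card_inj_on_le)
    show "g ` (nonsingular n \<times> ?U \<times> ?V) \<subseteq> good_pairs n"
    proof (rule image_subsetI, clarify)
      fix A u z assume A: "A \<in> nonsingular n" and u: "u \<in> ?U" and z: "z \<in> ?V"
      have "g (A, u, z) = (A, snd (g (A, u, z)))" by (simp add: g_def)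
      moreover have "(A, snd (g (A, u, z))) \<in> good_pairs n"
        unfolding good_pairs_def using ex[OF A u z] A u by (auto intro!: bexI[of _ u])
      ultimately show "g (A, u, z) \<in> good_pairs n" by simp
    qed
    \<comment> \<open>The pair determines its origin: \<open>u 0\<close> is fixed,
      \<open>u (Suc i)\<close> is recovered from the image of \<open>u i\<close> under the second
      matrix because \<open>A\<close> is injective, and \<open>z\<close> is the image of the last
      vector \<open>u (n - 1)\<close>.\<close>
    show "inj_on g (nonsingular n \<times> ?U \<times> ?V)"
    proof (rule inj_onI)
      fix p p' assume p: "p \<in> nonsingular n \<times> ?U \<times> ?V" "p' \<in> nonsingular n \<times> ?U \<times> ?V"
        and g: "g p = g p'"
      obtain A u z A' u' z' where pp: "p = (A, u, z)" "p' = (A', u', z')" by (metis prod_cases3)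
      have A: "A \<in> nonsingular n" "A' \<in> nonsingular n" and u: "u \<in> ?U" "u' \<in> ?U"
        and z: "z \<in> ?V" "z' \<in> ?V" and eq: "g (A, u, z) = g (A', u', z')"
        using p g unfolding pp by blast+
      have AA: "A = A'" using eq by (simp add: g_def)
      let ?B = "snd (g (A, u, z))"
      have P: "?P A u z ?B" by (rule ex[OF A(1) u(1) z(1)])
      have P': "?P A u' z' ?B" using ex[OF A(2) u(2) z(2)] unfolding eq[symmetric] AA .
      have "u i = u' i" if "i < n" for i
        using that
      proof (induction i)
        case 0
        then show ?case using u by (auto simp: indep_seqs_def)
      next
        case (Suc i)
        then have "mat_vec R n A (u (Suc i)) = mat_vec R n A (u' (Suc i))"
          using P[THEN conjunct2, rule_format, of i] P'[THEN conjunct2, rule_format, of i] by simp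
        moreover have "u (Suc i) \<in> ?V" "u' (Suc i) \<in> ?V"
          using Suc.prems u by (auto simp: indep_seqs_def)
        ultimately show ?case using A(1) by (auto simp: nonsingular_def dest: inj_onD)
      qed
      then have uu: "u = u'" by (rule indep_seqs_eqI[OF u])
      then have "z = z'"
        using P[THEN conjunct2, rule_format, of "n - 1"] P'[THEN conjunct2, rule_format, of "n - 1"] n
        by auto
      then show "p = p'" unfolding pp using AA uu by simp
    qed
    have "good_pairs n \<subseteq> mats n \<times> mats n" by (auto simp: good_pairs_def nonsingular_def)
    then show "finite (good_pairs n)" by (rule finite_subset) (simp add: finite_mats)
  qed
  then show ?thesis by (simp add: card_cartesian_product card_vecs)
qed

end

section \<open>Random forms\<close>

text \<open>These are the first terms of Euler's pentagonal number expansion of the infinite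
  product. The induction needs the extra term \<open>x ^ Suc m\<close>, which pays for the next
  factor.\<close>

lemma prod_one_minus_power_ge:
  fixes x :: real
  assumes x: "0 \<le> x" "x \<le> 1"
  shows "1 - x - x\<^sup>2 \<le> (\<Prod>j\<in>{1..<n}. 1 - x ^ j)"
proof (cases "n \<le> 1")
  case True
  then have "{1..<n} = {}" by simp
  then show ?thesis using x zero_le_power2[of x] by (simp only: prod.empty)
next
  case False
  have "1 - x - x\<^sup>2 + x ^ Suc m \<le> (\<Prod>j\<in>{1..<Suc m}. 1 - x ^ j)" if "1 \<le> m" for m
    using that
  proof (induction m rule: nat_induct_at_least)
    case base
    then show ?case by (simp add: power2_eq_square)
  next
    case (Suc m)
    have "x ^ (2 * m + 2) \<le> x ^ (m + 3)" using x Suc.hyps by (intro power_decreasing) auto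
    moreover have "(1 - x - x\<^sup>2 + x ^ Suc m) * (1 - x ^ Suc m) =
        1 - x - x\<^sup>2 + x ^ Suc (Suc m) + (x ^ (m + 3) - x ^ (2 * m + 2))"
      by (simp add: algebra_simps power2_eq_square power_add[symmetric] power3_eq_cube
          mult_2[symmetric] numeral_3_eq_3)
    ultimately have "1 - x - x\<^sup>2 + x ^ Suc (Suc m) \<le> (1 - x - x\<^sup>2 + x ^ Suc m) * (1 - x ^ Suc m)"
      by simp
    also have "\<dots> \<le> (\<Prod>j\<in>{1..<Suc m}. 1 - x ^ j) * (1 - x ^ Suc m)"
      using Suc.IH x by (intro mult_right_mono) (auto simp: power_le_one simp del: power_Suc)
    also have "\<dots> = (\<Prod>j\<in>{1..<Suc (Suc m)}. 1 - x ^ j)" by (simp del: power_Suc)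
    finally show ?case .
  qed
  from this[of "n - 1"] False have "1 - x - x\<^sup>2 + x ^ n \<le> (\<Prod>j\<in>{1..<n}. 1 - x ^ j)" by simp
  moreover have "0 \<le> x ^ n" using x by simp
  ultimately show ?thesis by linarith
qed

text \<open>The exponent 20 is a round number for which two checks succeed. For \<open>q = 2\<close>
  the failure rate is 15/16, and its 20th power is below 1/2. For \<open>q \<ge> 3\<close> the rate
  is at most \<open>8 / 3 * x\<close> with \<open>x \<le> 1 / 3\<close>.\<close>

lemma failure_rate_bound:
  fixes q :: nat
  assumes q: "2 \<le> q"
  defines "x \<equiv> 1 / real q"
  shows "1 - (1 - x - x\<^sup>2)\<^sup>2 \<le> real q powr (- 1 / 20)"
proof -
  let ?B = "1 - (1 - x - x\<^sup>2)\<^sup>2"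
  have "?B ^ 20 \<le> x"
  proof (cases "q = 2")
    case True
    then show ?thesis by (simp add: x_def power_divide power2_eq_square)
  next
    case False
    then have q3: "3 \<le> q" using q by simp
    have x: "0 < x" "x \<le> 1 / 3" using q3 by (auto simp: x_def field_simps)
    have "x * x \<le> x * (1 / 3)" using x by (intro mult_left_mono) auto
    then have "x + x\<^sup>2 \<le> 4 / 3 * x" by (simp add: power2_eq_square)
    then have "2 * (x + x\<^sup>2) \<le> 8 / 3 * x" by simp
    moreover have "?B = 2 * (x + x\<^sup>2) - (x + x\<^sup>2)\<^sup>2" by (simp add: power2_eq_square algebra_simps)
    then have "?B \<le> 2 * (x + x\<^sup>2)" by simp
    ultimately have B: "?B \<le> 8 / 3 * x" by (rule order_trans[rotated])
    have x1: "0 \<le> x + x\<^sup>2" "x + x\<^sup>2 \<le> 1" using x \<open>x + x\<^sup>2 \<le> 4 / 3 * x\<close> by auto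
    have "(1 - x - x\<^sup>2)\<^sup>2 \<le> 1" using x1 by (intro power_le_one) auto
    then have "?B ^ 20 \<le> (8 / 3 * x) ^ 20" using B by (intro power_mono) auto
    \<comment> \<open>One factor \<open>x\<close> is kept as the target; the other 19 are bounded by
      1/3 and absorb the constant.\<close>
    also have "\<dots> = (8 / 3) ^ 20 * x ^ 19 * x" by (simp add: power_mult_distrib power_eq_if)
    also have "\<dots> \<le> (8 / 3) ^ 20 * (1 / 3) ^ 19 * x"
      using x by (intro mult_right_mono mult_left_mono power_mono) auto
    also have "\<dots> \<le> 1 * x" using x by (intro mult_right_mono) (auto simp: power_divide)
    finally show ?thesis by simp
  qed
  moreover have "(real q powr (- 1 / 20)) ^ 20 = x"
  proof -
    have "(real q powr (- 1 / 20)) ^ 20 = real q powr (real 20 * (- 1 / 20))"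
      using q by (intro powr_power) simp
    also have "real 20 * (- 1 / 20) = - 1" by simp
    finally show ?thesis by (simp add: x_def powr_minus_divide)
  qed
  ultimately have "?B ^ Suc 19 \<le> (real q powr (- 1 / 20)) ^ Suc 19"
    by (simp only: Suc_numeral add_num_simps)
  then show ?thesis by (rule power_le_imp_le_base) simp
qed

context field
begin

lemma linear_form_finsum:
  fixes m :: nat
  assumes "\<And>i. i < m \<Longrightarrow> linear_form R n (l i)"
  shows "linear_form R n (\<lambda>x. \<Oplus>i\<in>{..<m}. l i x)"
  unfolding linear_form_def
proof (intro conjI ballI)
  have cl: "l i x \<in> carrier R" if "i < m" "x \<in> vecs R n" for i x
    using assms[OF that(1)] that(2) unfolding linear_form_def by blast
  show "(\<lambda>x. \<Oplus>i\<in>{..<m}. l i x) \<in> vecs R n \<rightarrow> carrier R"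
    by (auto intro!: finsum_closed cl)
  fix u assume u: "u \<in> vecs R n"
  {
    fix v assume v: "v \<in> vecs R n"
    have "(\<Oplus>i\<in>{..<m}. l i (vec_add R n u v)) = (\<Oplus>i\<in>{..<m}. l i u \<oplus> l i v)"
      using assms u v cl by (intro finsum_cong') (auto simp: linear_form_def)
    also have "\<dots> = (\<Oplus>i\<in>{..<m}. l i u) \<oplus> (\<Oplus>i\<in>{..<m}. l i v)"
      using u v cl by (intro finsum_addf) auto
    finally show "(\<Oplus>i\<in>{..<m}. l i (vec_add R n u v)) = (\<Oplus>i\<in>{..<m}. l i u) \<oplus> (\<Oplus>i\<in>{..<m}. l i v)" .
  }
next
  have cl: "l i x \<in> carrier R" if "i < m" "x \<in> vecs R n" for i x
    using assms[OF that(1)] that(2) unfolding linear_form_def by blast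
  fix c u assume c: "c \<in> carrier R" and u: "u \<in> vecs R n"
  have "(\<Oplus>i\<in>{..<m}. l i (vec_scale R n c u)) = (\<Oplus>i\<in>{..<m}. c \<otimes> l i u)"
    using assms u c cl by (intro finsum_cong') (auto simp: linear_form_def)
  also have "\<dots> = c \<otimes> (\<Oplus>i\<in>{..<m}. l i u)"
    using u c cl by (intro finsum_rdistr[symmetric]) auto
  finally show "(\<Oplus>i\<in>{..<m}. l i (vec_scale R n c u)) = c \<otimes> (\<Oplus>i\<in>{..<m}. l i u)" .
qed

lemma linear_form_entry:
  assumes "i < n" "a \<in> carrier R" "b \<in> carrier R" "c \<in> carrier R"
  shows "linear_form R n (\<lambda>x. a \<otimes> x i \<otimes> b \<otimes> c)" "linear_form R n (\<lambda>x. a \<otimes> b \<otimes> x i \<otimes> c)"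
    "linear_form R n (\<lambda>x. a \<otimes> b \<otimes> c \<otimes> x i)"
  using assms unfolding linear_form_def
  by (auto simp: vec_add_def vec_scale_def vecs_entry l_distr r_distr m_ac)

lemma form_of_array_trilinear:
  assumes a: "\<And>i j k. i < n \<Longrightarrow> j < n \<Longrightarrow> k < n \<Longrightarrow> a (i, j, k) \<in> carrier R"
  shows "trilinear R n (form_of_array R n a)"
  unfolding trilinear_def form_of_array_def
  by (intro ballI conjI linear_form_finsum linear_form_entry) (auto intro: a vecs_entry)

end

section \<open>From slices of the array to the probability of a bad form\<close>

definition slice :: "nat \<Rightarrow> (nat \<times> nat \<times> nat \<Rightarrow> 'a) \<Rightarrow> nat \<Rightarrow> 'a sqmat" where
  "slice n a i = (\<lambda>(j, k)\<in>{..<n} \<times> {..<n}. a (i, j, k))"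

context finite_field
begin

text \<open>Total functions that vanish off the index cube, in accordance with the default value of
  \<open>Pi_pmf\<close>.\<close>

abbreviation arrays :: "nat \<Rightarrow> (nat \<times> nat \<times> nat \<Rightarrow> 'a) set" where
  "arrays n \<equiv> PiE_dflt ({..<n} \<times> {..<n} \<times> {..<n}) \<zero> (\<lambda>_. carrier R)"

lemma array_entry: "a \<in> arrays n \<Longrightarrow> i < n \<Longrightarrow> j < n \<Longrightarrow> k < n \<Longrightarrow> a (i, j, k) \<in> carrier R"
  by (auto simp: PiE_dflt_def)

lemma slice_closed: "a \<in> arrays n \<Longrightarrow> i < n \<Longrightarrow> slice n a i \<in> mats n"
  by (auto simp: slice_def mat_monoid_def intro: array_entry)

text \<open>Fixing the first argument to \<open>e_i\<close> leaves the bilinear form of slice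
  \<open>i\<close>, so equations valid for all \<open>y\<close> become equations between
  matrix-vector products.\<close>

lemma form_of_array_std_basis:
  assumes a: "a \<in> arrays n" and i: "i < n" and y: "y \<in> vecs R n" and w: "w \<in> vecs R n"
  shows "form_of_array R n a (std_basis R n i) y w =
    (\<Oplus>j\<in>{..<n}. y j \<otimes> mat_vec R n (slice n a i) w j)"
proof -
  let ?X = "\<lambda>i. \<Oplus>j\<in>{..<n}. y j \<otimes> mat_vec R n (slice n a i) w j"
  note cl = array_entry[OF a] vecs_entry[OF y] vecs_entry[OF w]
  have mv: "mat_vec R n (slice n a i) w j = (\<Oplus>k\<in>{..<n}. a (i, j, k) \<otimes> w k)" if "i < n" "j < n" for i j
    using that unfolding mat_vec_def by (simp, intro finsum_cong') (auto simp: slice_def cl)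
  have X: "?X i \<in> carrier R" if "i < n" for i
    using that by (intro finsum_closed) (auto simp: mv intro!: m_closed finsum_closed cl)
  have "(\<Oplus>j\<in>{..<n}. \<Oplus>k\<in>{..<n}. a (i', j, k) \<otimes> std_basis R n i i' \<otimes> y j \<otimes> w k) =
      (if i = i' then ?X i' else \<zero>)" if i': "i' < n" for i'
  proof (cases "i = i'")
    case True
    have "(\<Oplus>k\<in>{..<n}. a (i', j, k) \<otimes> std_basis R n i i' \<otimes> y j \<otimes> w k) =
        y j \<otimes> mat_vec R n (slice n a i') w j" if j: "j < n" for j
    proof -
      have "(\<Oplus>k\<in>{..<n}. a (i', j, k) \<otimes> std_basis R n i i' \<otimes> y j \<otimes> w k) =
          (\<Oplus>k\<in>{..<n}. y j \<otimes> (a (i', j, k) \<otimes> w k))"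
        using True i' j by (intro finsum_cong') (auto simp: std_basis_def cl m_ac)
      also have "\<dots> = y j \<otimes> (\<Oplus>k\<in>{..<n}. a (i', j, k) \<otimes> w k)"
        using i' j by (intro finsum_rdistr[symmetric]) (auto simp: cl)
      finally show ?thesis using i' j by (simp add: mv)
    qed
    moreover have "mat_vec R n (slice n a i') w j \<in> carrier R" if "j < n" for j
      using that i' by (auto simp: mv intro!: finsum_closed cl)
    ultimately have "(\<Oplus>j\<in>{..<n}. \<Oplus>k\<in>{..<n}. a (i', j, k) \<otimes> std_basis R n i i' \<otimes> y j \<otimes> w k) = ?X i'"
      by (intro finsum_cong') (auto simp: cl)
    then show ?thesis using True by simp
  next
    case False
    have "(\<Oplus>k\<in>{..<n}. a (i', j, k) \<otimes> std_basis R n i i' \<otimes> y j \<otimes> w k) = \<zero>" if j: "j < n" for j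
    proof -
      have "(\<Oplus>k\<in>{..<n}. a (i', j, k) \<otimes> std_basis R n i i' \<otimes> y j \<otimes> w k) = (\<Oplus>k\<in>{..<n}. \<zero>)"
        using False i' j by (intro finsum_cong') (auto simp: std_basis_def cl)
      then show ?thesis by simp
    qed
    then have "(\<Oplus>j\<in>{..<n}. \<Oplus>k\<in>{..<n}. a (i', j, k) \<otimes> std_basis R n i i' \<otimes> y j \<otimes> w k) =
        (\<Oplus>j\<in>{..<n}. \<zero>)"
      by (intro finsum_cong') auto
    then show ?thesis using False by simp
  qed
  then have "form_of_array R n a (std_basis R n i) y w = (\<Oplus>i'\<in>{..<n}. if i = i' then ?X i' else \<zero>)"
    unfolding form_of_array_def by (intro finsum_cong') (auto intro: X)
  also have "\<dots> = ?X i"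
    by (rule add.finprod_singleton) (use i X in auto)
  finally show ?thesis .
qed

lemma good_form_if_good_pair:
  assumes a: "a \<in> arrays n" and "i < n" "i' < n"
    and good: "(slice n a i, slice n a i') \<in> good_pairs n"
  shows "good_form R n (form_of_array R n a)"
proof -
  let ?f = "form_of_array R n a" and ?V = "vecs R n"
  let ?A = "slice n a i" and ?B = "slice n a i'"
  obtain u where A: "?A \<in> mats n" "inj_on (mat_vec R n ?A) ?V" and u: "u \<in> indep_seqs n {std_basis R n 0} n"
    and step: "\<And>k. Suc k < n \<Longrightarrow> mat_vec R n ?A (u (Suc k)) = mat_vec R n ?B (u k)"
    using good by (auto simp: good_pairs_def nonsingular_def)
  have uV: "u k \<in> ?V" if "k < n" for k using u that by (auto simp: indep_seqs_def)
  note mvA = linear_map_closed[OF mat_vec_linear[OF A(1)]]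
  have "good_chain R n ?f (std_basis R n i) (std_basis R n i') u"
    unfolding good_chain_def
  proof (intro conjI ballI allI impI)
    fix w w' assume w: "w \<in> ?V" "w' \<in> ?V"
      and eq: "\<forall>y\<in>?V. ?f (std_basis R n i) y w = ?f (std_basis R n i) y w'"
    have "mat_vec R n ?A w = mat_vec R n ?A w'"
    proof (rule vecs_eqI[OF mvA[OF w(1)] mvA[OF w(2)]])
      fix j assume j: "j < n"
      \<comment> \<open>Testing with the \<open>j\<close>-th standard basis vector as
        \<open>y\<close> extracts coordinate \<open>j\<close>.\<close>
      have s: "(\<Oplus>j'\<in>{..<n}. std_basis R n j j' \<otimes> v j') = v j" if v: "v \<in> ?V" for v
      proof -
        have "(\<Oplus>j'\<in>{..<n}. std_basis R n j j' \<otimes> v j') = (\<Oplus>j'\<in>{..<n}. if j = j' then v j' else \<zero>)"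
          by (intro finsum_cong') (auto simp: std_basis_def vecs_entry[OF v])
        also have "\<dots> = v j"
          by (rule add.finprod_singleton) (auto simp: j vecs_entry[OF v])
        finally show ?thesis .
      qed
      show "mat_vec R n ?A w j = mat_vec R n ?A w' j"
        using eq[rule_format, OF std_basis_closed[of n j]]
        unfolding form_of_array_std_basis[OF a assms(2) std_basis_closed w(1)]
          form_of_array_std_basis[OF a assms(2) std_basis_closed w(2)]
          s[OF mvA[OF w(1)]] s[OF mvA[OF w(2)]] .
    qed
    then show "w = w'" using A(2) w by (auto dest: inj_onD)
  next
    fix k y assume k: "Suc k < n" and y: "y \<in> ?V"
    show "?f (std_basis R n i) y (u (Suc k)) = ?f (std_basis R n i') y (u k)"
      using form_of_array_std_basis[OF a assms(2) y uV[OF k]]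
        form_of_array_std_basis[OF a assms(3) y uV[OF Suc_lessD[OF k]]] step[OF k] by simp
  qed (use uV in auto)
  moreover have "inj_on (lin_comb R n n u) ?V" using u by (auto simp: indep_seqs_def)
  ultimately show ?thesis unfolding good_form_def by (meson std_basis_closed)
qed

text \<open>With N = q^n, there are at least N^n times the product of \<open>1 - x ^ j\<close> over
  \<open>1 \<le> j \<le> n\<close> choices of \<open>A\<close>, at least N^(n-1) times the product
  over \<open>1 \<le> j < n\<close> choices of the sequence, and N free last images. Each product is
  at least 1 - x - x^2, hence the square.\<close>

lemma card_good_pairs_ge:
  assumes n: "0 < n"
  defines "x \<equiv> 1 / real q"
  shows "(1 - x - x\<^sup>2)\<^sup>2 * (real (card (mats n)))\<^sup>2 \<le> real (card (good_pairs n))"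
proof -
  let ?N = "real q ^ n" and ?z = "\<lambda>i\<in>{..<n}. \<zero>" and ?p = "\<Prod>j\<in>{1..<n}. 1 - x ^ j"
  have x: "0 < x" "x \<le> 1 / 2" using q_ge_2 by (auto simp: x_def field_simps)
  have qx: "real q * x = 1" using q_ge_2 by (simp add: x_def)
  have factor: "real (q ^ n - q ^ j) = ?N * (1 - x ^ (n - j))" if "j \<le> n" for j
  proof -
    have "?N * x ^ (n - j) = real q ^ j * (real q * x) ^ (n - j)"
      using that by (simp add: power_mult_distrib power_add[symmetric] mult.assoc[symmetric])
    then have "?N * x ^ (n - j) = real q ^ j" by (simp add: qx)
    moreover have "q ^ j \<le> q ^ n" using that q_ge_2 by (intro power_increasing) auto
    ultimately show ?thesis by (simp add: of_nat_diff algebra_simps)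
  qed
  have prod: "real (\<Prod>j\<in>{1..<n}. q ^ n - q ^ j) = ?N ^ (n - 1) * ?p"
  proof -
    have "real (\<Prod>j\<in>{1..<n}. q ^ n - q ^ j) = (\<Prod>j\<in>{1..<n}. ?N * (1 - x ^ (n - j)))"
      unfolding of_nat_prod by (intro prod.cong) (auto simp: factor)
    \<comment> \<open>The count for \<open>j\<close> vectors leaves the exponent
      \<open>n - j\<close>; reversing the index turns it into \<open>j\<close>.\<close>
    also have "\<dots> = ?N ^ (n - 1) * (\<Prod>j\<in>{1..<n}. 1 - x ^ (n - j))" by (simp add: prod.distrib)
    also have "(\<Prod>j\<in>{1..<n}. 1 - x ^ (n - j)) = ?p"
      by (subst prod.atLeastLessThan_rev) simp
    finally show ?thesis .
  qed
  have sn: "Suc (n - 1) = n" using n by simp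
  have zV: "?z \<in> vecs R n" by (intro vecs_restrict) simp
  have "card (vecs R n - {?z}) = q ^ n - q ^ 0"
    using zV by (subst card_Diff_singleton) (simp_all only: card_vecs power_0)
  then have "real (card (vecs R n - {?z})) = ?N * (1 - x ^ n)" using factor[of 0] by simp
  moreover have "real (card (vecs R n - {?z}) * (\<Prod>j\<in>{1..<n}. q ^ n - q ^ j)) \<le>
      real (card (nonsingular n))"
    using card_indep_seqs[OF order.refl, of n "n - 1"] card_nonsingular[of n]
    unfolding sn by (simp only: of_nat_le_iff)
  ultimately have G: "?N ^ n * (?p * (1 - x ^ n)) \<le> real (card (nonsingular n))"
    using sn unfolding of_nat_mult prod
    by (simp only: ac_simps power_Suc[symmetric])
  have "std_basis R n 0 0 \<noteq> ?z 0" using n by (simp add: std_basis_def)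
  then have "std_basis R n 0 \<noteq> ?z" by metis
  then have "card ({std_basis R n 0} - {?z}) = 1" by (subst Diff_triv) simp_all
  then have U: "?N ^ (n - 1) * ?p \<le> real (card (indep_seqs n {std_basis R n 0} n))"
    using card_indep_seqs[of "{std_basis R n 0}" n "n - 1"] std_basis_closed[of n 0]
    unfolding sn prod[symmetric] by (simp only: of_nat_le_iff) simp
  have p: "1 - x - x\<^sup>2 \<le> ?p" "1 - x - x\<^sup>2 \<le> ?p * (1 - x ^ n)"
    using prod_one_minus_power_ge[of x n] prod_one_minus_power_ge[of x "Suc n"] x n by auto
  have "x * x \<le> 1 / 2 * (1 / 2)" using x by (intro mult_mono) auto
  then have e0: "0 \<le> 1 - x - x\<^sup>2" using x by (simp add: power2_eq_square)
  have M: "real (card (mats n)) = ?N ^ n" by (simp add: card_mats)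
  have xn: "x ^ n \<le> 1" using x by (intro power_le_one) auto
  have "(1 - x - x\<^sup>2)\<^sup>2 * (real (card (mats n)))\<^sup>2 =
      (?N ^ n * (1 - x - x\<^sup>2)) * ((?N ^ (n - 1) * (1 - x - x\<^sup>2)) * ?N)"
  proof -
    have "?N ^ n = ?N ^ (n - 1) * ?N" using sn by (metis power_Suc2)
    then show ?thesis unfolding M power2_eq_square by (simp only: ac_simps)
  qed
  also have "\<dots> \<le> (?N ^ n * (?p * (1 - x ^ n))) * ((?N ^ (n - 1) * ?p) * ?N)"
    by (intro mult_mono mult_nonneg_nonneg) (use p e0 xn in auto)
  also have "\<dots> \<le> real (card (nonsingular n)) * (real (card (indep_seqs n {std_basis R n 0} n)) * ?N)"
    by (intro mult_mono G U mult_nonneg_nonneg) (use p e0 xn in auto)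
  also have "\<dots> \<le> real (card (good_pairs n))"
    using card_good_pairs[OF n] by (simp only: of_nat_mult[symmetric] of_nat_power[symmetric] of_nat_le_iff)
  finally show ?thesis .
qed

text \<open>Independence of the pairs in counting form: an array amounts to its \<open>m\<close>
  pairs of slices together with the leftover slice that exists for odd \<open>n\<close>.\<close>

lemma card_arrays_pairs:
  assumes B: "B \<subseteq> mats n \<times> mats n"
  defines "m \<equiv> n div 2"
  shows "card {a \<in> arrays n. \<forall>t<m. (slice n a (2 * t), slice n a (2 * t + 1)) \<in> B} \<le>
    card B ^ m * card (mats n) ^ (n - 2 * m)"
proof -
  let ?S = "{a \<in> arrays n. \<forall>t<m. (slice n a (2 * t), slice n a (2 * t + 1)) \<in> B}"
  let ?g = "\<lambda>a. (\<lambda>t\<in>{..<m}. (slice n a (2 * t), slice n a (2 * t + 1)), \<lambda>i\<in>{2 * m..<n}. slice n a i)"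
  let ?T = "({..<m} \<rightarrow>\<^sub>E B) \<times> ({2 * m..<n} \<rightarrow>\<^sub>E mats n)"
  have fB: "finite B" by (rule finite_subset[OF B]) (simp add: finite_mats)
  have "card ?S \<le> card ?T"
  proof (rule card_inj_on_le)
    show "inj_on ?g ?S"
    proof (rule inj_onI)
      fix a b assume a: "a \<in> ?S" and b: "b \<in> ?S" and eq: "?g a = ?g b"
      have e1: "(\<lambda>t\<in>{..<m}. (slice n a (2 * t), slice n a (2 * t + 1))) =
          (\<lambda>t\<in>{..<m}. (slice n b (2 * t), slice n b (2 * t + 1)))"
        and e2: "(\<lambda>i\<in>{2 * m..<n}. slice n a i) = (\<lambda>i\<in>{2 * m..<n}. slice n b i)"
        using eq by (simp_all only: prod.inject)
      have sl: "slice n a i = slice n b i" if i: "i < n" for i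
      proof (cases "i < 2 * m")
        case True
        then have t: "i div 2 < m" by auto
        have p: "slice n a (2 * (i div 2)) = slice n b (2 * (i div 2))"
          "slice n a (2 * (i div 2) + 1) = slice n b (2 * (i div 2) + 1)"
          using fun_cong[OF e1, of "i div 2"] t by simp_all
        show ?thesis
        proof (cases "even i")
          case True
          then show ?thesis using p(1) by simp
        next
          case False
          then show ?thesis using p(2) by simp
        qed
      next
        case False
        then show ?thesis using fun_cong[OF e2, of i] i by simp
      qed
      show "a = b"
      proof (rule ext)
        fix p :: "nat \<times> nat \<times> nat"
        obtain i j k where p: "p = (i, j, k)" by (metis prod_cases3)
        show "a p = b p"
        proof (cases "i < n \<and> j < n \<and> k < n")
          case True
          then show ?thesis using fun_cong[OF sl[of i], of "(j, k)"] by (simp add: slice_def p)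
        next
          case False
          then have "a p = \<zero>" "b p = \<zero>" using a b by (auto simp: PiE_dflt_def p)
          then show ?thesis by simp
        qed
      qed
    qed
    show "?g ` ?S \<subseteq> ?T"
    proof (rule image_subsetI)
      fix a assume "a \<in> ?S"
      then have a: "a \<in> arrays n" and "\<And>t. t < m \<Longrightarrow> (slice n a (2 * t), slice n a (2 * t + 1)) \<in> B"
        by blast+
      then have "(\<lambda>t\<in>{..<m}. (slice n a (2 * t), slice n a (2 * t + 1))) \<in> {..<m} \<rightarrow>\<^sub>E B"
        unfolding restrict_PiE_iff by blast
      moreover have "(\<lambda>i\<in>{2 * m..<n}. slice n a i) \<in> {2 * m..<n} \<rightarrow>\<^sub>E mats n"
        unfolding restrict_PiE_iff using slice_closed[OF a] by simp
      ultimately show "?g a \<in> ?T" by (rule SigmaI)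
    qed
    show "finite ?T" using fB finite_mats by (intro finite_cartesian_product finite_PiE) auto
  qed
  also have "card ?T = card B ^ m * card (mats n) ^ (n - 2 * m)"
    by (simp add: card_cartesian_product card_PiE)
  finally show ?thesis .
qed

lemma card_arrays: "card (arrays n) = card (mats n) ^ n"
  by (simp add: card_PiE_dflt finite_carrier card_mats power_mult[symmetric] mult_ac)

text \<open>A single good pair of slices makes the form good, so in a bad form all
  \<open>n div 2\<close> pairs fail, and the failure rates multiply.\<close>

lemma prob_not_good_form:
  "measure_pmf.prob (random_trilinear_form R n) {f. \<not> (trilinear R n f \<and> good_form R n f)} \<le>
    1 / real q powr (real (n div 2) / 20)"
proof -
  let ?m = "n div 2" and ?M = "real (card (mats n))" and ?x = "1 / real q"
  let ?Bad = "mats n \<times> mats n - good_pairs n"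
  let ?E = "{a \<in> arrays n. \<forall>t<?m. (slice n a (2 * t), slice n a (2 * t + 1)) \<in> ?Bad}"
  let ?\<beta> = "real q powr (- 1 / 20)"
  have M0: "0 < ?M" using q_ge_2 by (simp add: card_mats)
  have fin: "finite (arrays n)" by (intro finite_PiE_dflt) (auto intro: finite_carrier)
  have cA: "real (card (arrays n)) = ?M ^ n" by (simp add: card_arrays)
  then have ne: "arrays n \<noteq> {}" using M0 by (metis card.empty of_nat_0 power_not_zero less_irrefl)
  have "random_trilinear_form R n = map_pmf (form_of_array R n) (pmf_of_set (arrays n))"
    unfolding random_trilinear_form_def
    by (subst Pi_pmf_of_set) (auto intro: finite_carrier)
  then have "measure_pmf.prob (random_trilinear_form R n) {f. \<not> (trilinear R n f \<and> good_form R n f)} =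
      real (card (arrays n \<inter> form_of_array R n -` {f. \<not> (trilinear R n f \<and> good_form R n f)})) / ?M ^ n"
    by (simp only: measure_map_pmf measure_pmf_of_set[OF ne fin] cA)
  also have "\<dots> \<le> real (card ?E) / ?M ^ n"
  proof (intro divide_right_mono of_nat_mono card_mono)
    show "arrays n \<inter> form_of_array R n -` {f. \<not> (trilinear R n f \<and> good_form R n f)} \<subseteq> ?E"
    proof
      fix a assume "a \<in> arrays n \<inter> form_of_array R n -` {f. \<not> (trilinear R n f \<and> good_form R n f)}"
      then have a: "a \<in> arrays n" and "\<not> (trilinear R n (form_of_array R n a) \<and> good_form R n (form_of_array R n a))"
        by auto
      moreover have "trilinear R n (form_of_array R n a)"
        by (rule form_of_array_trilinear) (rule array_entry[OF a])
      ultimately have ng: "\<not> good_form R n (form_of_array R n a)" by blast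
      have "(slice n a (2 * t), slice n a (2 * t + 1)) \<in> ?Bad" if "t < ?m" for t
      proof -
        have t: "2 * t < n" "2 * t + 1 < n" using that by auto
        then show ?thesis
          using good_form_if_good_pair[OF a t] ng slice_closed[OF a t(1)] slice_closed[OF a t(2)]
          by blast
      qed
      then show "a \<in> ?E" using a by blast
    qed
  qed (use fin in auto)
  also have "\<dots> \<le> ?\<beta> ^ ?m"
  proof (cases "?m = 0")
    \<comment> \<open>Without a pair the bound is the trivial bound 1.\<close>
    case True
    have "card ?E \<le> card (arrays n)" using fin by (intro card_mono) auto
    then have "real (card ?E) \<le> ?M ^ n" unfolding cA[symmetric] by simp
    then show ?thesis using True M0 by simp
  next
    case False
    then have n: "0 < n" by auto
    have sub: "good_pairs n \<subseteq> mats n \<times> mats n" by (auto simp: good_pairs_def nonsingular_def)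
    have "real (card ?Bad) = ?M\<^sup>2 - real (card (good_pairs n))"
      using sub finite_subset[OF sub] card_mono[OF _ sub]
      by (simp add: card_Diff_subset finite_mats card_cartesian_product of_nat_diff power2_eq_square)
    also have "\<dots> \<le> (1 - (1 - ?x - ?x\<^sup>2)\<^sup>2) * ?M\<^sup>2"
      using card_good_pairs_ge[OF n] by (simp add: algebra_simps)
    also have "\<dots> \<le> ?\<beta> * ?M\<^sup>2"
      using failure_rate_bound[OF q_ge_2] by (intro mult_right_mono) auto
    finally have Bad: "real (card ?Bad) \<le> ?\<beta> * ?M\<^sup>2" .
    have "real (card ?E) \<le> real (card ?Bad) ^ ?m * ?M ^ (n - 2 * ?m)"
      using card_arrays_pairs[of ?Bad n] by (simp only: of_nat_mult[symmetric] of_nat_power[symmetric] of_nat_le_iff Diff_subset)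
    also have "\<dots> \<le> (?\<beta> * ?M\<^sup>2) ^ ?m * ?M ^ (n - 2 * ?m)"
      by (intro mult_right_mono power_mono Bad) auto
    also have "\<dots> = ?\<beta> ^ ?m * ?M ^ (2 * ?m + (n - 2 * ?m))"
      by (simp only: power_mult_distrib power_mult power_add mult.assoc)
    also have "2 * ?m + (n - 2 * ?m) = n" by simp
    finally show ?thesis using M0 by (simp add: divide_le_eq)
  qed
  also have "?\<beta> ^ ?m = 1 / real q powr (real ?m / 20)"
  proof -
    have "?\<beta> ^ ?m = real q powr (real ?m * (- 1 / 20))"
      using q_ge_2 by (intro powr_power) auto
    also have "real ?m * (- 1 / 20) = - (real ?m / 20)" by simp
    finally show ?thesis by (simp only: powr_minus_divide)
  qed
  finally show ?thesis .
qed

end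

section \<open>Explicit exponents for running time and failure probability\<close>

theorem theorem3p7:
  shows "\<exists>(alg :: com) (t :: nat \<Rightarrow> real) (h :: nat \<Rightarrow> real).
    t \<in> O(\<lambda>n. real n) \<and> h \<in> \<Omega>(\<lambda>n. real n) \<and> (\<forall>n. 0 \<le> h n) \<and>
    (\<forall>(F :: nat ring) (q :: nat) (n :: nat). field F \<and> carrier F = {..<q} \<longrightarrow>
       (\<forall>f g. trilinear F n f \<and> trilinear F n g \<longrightarrow>
          halts_within alg (input_state F n f g) (real q powr t n)) \<and>
       measure_pmf.prob (random_trilinear_form F n)
         {f. \<not> (\<forall>g. trilinear F n g \<longrightarrow>
                 answers alg (input_state F n f g) (equivalent_forms F n f g))}
         \<le> 1 / real q powr h n)"
proof -
  obtain alg K where alg: "\<And>\<sigma>. \<exists>t s'. exec alg \<sigma> t s' \<and> t \<le> input_size \<sigma> ^ K \<and>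
      s' ''out'' 0 = of_bool (accepts \<sigma>)"
    using accepts_program by blast
  \<comment> \<open>From \<open>q + 2 \<le> q ^ 2\<close> for \<open>q \<ge> 2\<close>: the base of
    \<open>input_size\<close> becomes \<open>q\<close> and the exponent doubles.\<close>
  define t where "t = (\<lambda>n. real (2 * (n + 1) * K))"
  define h where "h = (\<lambda>n. real (n div 2) / 20)"
  have "t \<in> O(\<lambda>n. real n)"
  proof (rule bigoI[where c = "4 * real K"])
    show "eventually (\<lambda>n. norm (t n) \<le> 4 * real K * norm (real n)) sequentially"
      using eventually_ge_at_top[of 1]
    proof eventually_elim
      case (elim n)
      have "2 * (n + 1) * K \<le> 4 * n * K" using elim by (intro mult_right_mono) auto
      then have "real (2 * (n + 1) * K) \<le> real (4 * n * K)" by (rule of_nat_mono)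
      then show ?case by (simp add: t_def mult_ac)
    qed
  qed
  moreover have "h \<in> \<Omega>(\<lambda>n. real n)"
  proof (rule landau_omega.bigI[where c = "1 / 80"])
    \<comment> \<open>For \<open>n \<ge> 2\<close>, \<open>n div 2\<close> is at least a quarter of
      \<open>n\<close>, and \<open>h\<close> divides it by 20.\<close>
    show "eventually (\<lambda>n. 1 / 80 * norm (real n) \<le> norm (h n)) sequentially"
      using eventually_ge_at_top[of 2]
    proof eventually_elim
      case (elim n)
      then have "n \<le> 4 * (n div 2)" by presburger
      then have "real n \<le> real (4 * (n div 2))" by (rule of_nat_mono)
      then show ?case by (simp add: h_def)
    qed
  qed simp
  moreover have "\<forall>n. 0 \<le> h n" by (simp add: h_def)
  moreover have "halts_within alg (input_state F n f g) (real q powr t n)"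
    if F: "field F" and q: "carrier F = {..<q}" for F :: "nat ring" and q n f g
  proof -
    interpret field F by (rule F)
    interpret finite_field F by unfold_locales (simp add: q)
    have q2: "2 \<le> q" using q_ge_2 q by simp
    let ?\<sigma> = "input_state F n f g"
    have "input_size ?\<sigma> = (q + 2) ^ (n + 1)" by (simp add: input_size_def input_state_def q)
    also have "\<dots> \<le> (q ^ 2) ^ (n + 1)"
    proof (rule power_mono)
      have "q + 2 \<le> 2 * q" using q2 by simp
      also have "\<dots> \<le> q ^ 2" using q2 by (simp add: power2_eq_square)
      finally show "q + 2 \<le> q ^ 2" .
    qed simp
    finally have "input_size ?\<sigma> ^ K \<le> ((q ^ 2) ^ (n + 1)) ^ K" by (rule power_mono) simp
    also have "\<dots> = q ^ (2 * (n + 1) * K)" by (simp only: power_mult)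
    finally have "real (input_size ?\<sigma> ^ K) \<le> real q ^ (2 * (n + 1) * K)"
      by (simp only: of_nat_power[symmetric] of_nat_le_iff)
    also have "\<dots> = real q powr t n" unfolding t_def using q2 by (subst powr_realpow) auto
    finally have "real (input_size ?\<sigma> ^ K) \<le> real q powr t n" .
    then show ?thesis
      using alg[of ?\<sigma>] unfolding halts_within_def by (meson of_nat_mono order_trans)
  qed
  moreover have "measure_pmf.prob (random_trilinear_form F n)
      {f. \<not> (\<forall>g. trilinear F n g \<longrightarrow>
              answers alg (input_state F n f g) (equivalent_forms F n f g))}
      \<le> 1 / real q powr h n"
    if F: "field F" and q: "carrier F = {..<q}" for F :: "nat ring" and q n
  proof -
    interpret field F by (rule F)
    interpret finite_field F by unfold_locales (simp add: q)
    have "answers alg (input_state F n f g) (equivalent_forms F n f g)"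
      if f: "trilinear F n f" "good_form F n f" and g: "trilinear F n g" for f g
    proof -
      interpret coded_pair F q n "input_state F n f g" f g
        by (rule coded_pair_input_state[OF F q f(1) g])
      have "accepts (input_state F n f g) \<longleftrightarrow> equivalent_forms F n f g"
        using accepts_sound accepts_complete f(2) by blast
      then show ?thesis
        using alg[of "input_state F n f g"] unfolding answers_def of_bool_def by metis
    qed
    \<comment> \<open>Failure for some \<open>g\<close> already forces \<open>f\<close> to be bad,
      so no union over \<open>g\<close> is taken.\<close>
    then have "measure_pmf.prob (random_trilinear_form F n)
        {f. \<not> (\<forall>g. trilinear F n g \<longrightarrow>
                answers alg (input_state F n f g) (equivalent_forms F n f g))}
        \<le> measure_pmf.prob (random_trilinear_form F n) {f. \<not> (trilinear F n f \<and> good_form F n f)}"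
      by (intro measure_pmf.finite_measure_mono) auto
    also have "\<dots> \<le> 1 / real q powr h n"
      using prob_not_good_form[of n] by (simp add: q h_def)
    finally show ?thesis .
  qed
  ultimately show ?thesis
    by (intro exI[of _ alg] exI[of _ t] exI[of _ h]) blast
qed

end
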